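(* Let $f\in L^2(\Omega)$ and $g\in H_0^1(\Omega)$. For $\boldsymbol{u}=(u,\boldsymbol{\sigma},\lambda)\in U$ define $$J(\boldsymbol{u};f,g):=\|\operatorname{div}\boldsymbol{\sigma}+\lambda+f\|^2+\|\nabla u-\boldsymbol{\sigma}\|^2+\langle\lambda,u-g\rangle .$$ Then the first-order system (FO) and the minimization problem $$\text{(LS)}\qquad\text{find }\boldsymbol{u}\in K^s\text{ with } J(\boldsymbol{u};f,g)=\min_{\boldsymbol{v}\in K^s}J(\boldsymbol{v};f,g)$$ are equivalent (they have the same solutions). In particular, there exists a unique solution $\boldsymbol{u}\in K^s$ of (LS), and there is a constant $C_J>0$ depending only on $\Omega$ such that $$J(\boldsymbol{v};f,g)\ge C_J\,\|\boldsymbol{v}-\boldsymbol{u}\|_U^2\qquad\text{for all }\boldsymbol{v}\in K^s .$$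
   Context: $\Omega\subset\mathbb{R}^n$, $n\in\{2,3\}$, is a polygonal (polyhedral) bounded Lipschitz domain with boundary $\Gamma$. $(\cdot,\cdot)$ and $\|\cdot\|$ are the $L^2(\Omega)$ (or $L^2(\Omega)^n$) inner product and norm. $H^{-1}(\Omega)$ is the dual of $H_0^1(\Omega)$, with duality $\langle\cdot,\cdot\rangle$ extending the $L^2(\Omega)$ inner product. The generalized divergence $\operatorname{div}:L^2(\Omega)^n\to H^{-1}(\Omega)$ is $\langle\operatorname{div}\boldsymbol{\sigma},v\rangle:=-(\boldsymbol{\sigma},\nabla v)$ for $v\in H_0^1(\Omega)$. For $v\in H^1(\Omega)$, $v\ge0$ means $v\ge 0$ a.e. in $\Omega$; for $\lambda\in H^{-1}(\Omega)$, $\lambda\ge0$ means $\langle\lambda,v\rangle\ge0$ for all $v\in H_0^1(\Omega)$ with $v\ge0$. $U:=\{(u,\boldsymbol{\sigma},\lambda)\in H_0^1(\Omega)\times L^2(\Omega)^n\times H^{-1}(\Omega): \operatorname{div}\boldsymbol{\sigma}+\lambda\in L^2(\Omega)\}$ with norm $\|(u,\boldsymbol{\sigma},\lambda)\|_U^2:=\|\nabla u\|^2+\|\boldsymbol{\sigma}\|^2+\|\operatorname{div}\boldsymbol{\sigma}+\lambda\|^2$. $K^s:=\{(u,\boldsymbol{\sigma},\lambda)\in U: u-g\ge0,\ \lambda\ge0\}$. The first-order system (FO), a reformulation of the classical obstacle problem, is: find $(u,\boldsymbol{\sigma},\lambda)\in U$ with $-\operatorname{div}\boldsymbol{\sigma}-\lambda=f$,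 $\boldsymbol{\sigma}-\nabla u=0$, $u\ge g$, $\lambda\ge0$, $(u-g)\lambda=0$ in $\Omega$, and $u=0$ on $\Gamma$; here, for $g\in H_0^1(\Omega)$, the condition $(u-g)\lambda=0$ is understood as $\langle\lambda,u-g\rangle=0$. *)

theory Defs
  imports "HOL-Analysis.Analysis"
begin

text \<open>
  Elements of Lebesgue and Sobolev spaces over a set \<open>\<Omega>\<close> are given by representatives: total
  functions on the ambient space of which only the values on \<open>\<Omega>\<close>, up to null sets, matter.
\<close>

section \<open>Polyhedral Lipschitz domains\<close>

text \<open>
  Near each boundary point, \<open>\<Omega>\<close> is the strict epigraph, in some direction \<open>e\<close>, of a Lipschitz
  function on the hyperplane orthogonal to \<open>e\<close>.
\<close>

definition bounded_Lipschitz_domain :: "'a::euclidean_space set \<Rightarrow> bool" where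
  "bounded_Lipschitz_domain \<Omega> \<longleftrightarrow>
     open \<Omega> \<and> connected \<Omega> \<and> \<Omega> \<noteq> {} \<and> bounded \<Omega> \<and>
     (\<forall>p\<in>frontier \<Omega>. \<exists>r>0. \<exists>e L. \<exists>\<gamma>::'a \<Rightarrow> real.
        norm e = 1 \<and> L-lipschitz_on {y. y \<bullet> e = 0} \<gamma> \<and>
        (\<forall>x\<in>ball p r. x \<in> \<Omega> \<longleftrightarrow> \<gamma> (x - (x \<bullet> e) *\<^sub>R e) < x \<bullet> e))"

definition polyhedral_boundary :: "'a::euclidean_space set \<Rightarrow> bool" where
  "polyhedral_boundary \<Omega> \<longleftrightarrow>
     (\<exists>\<F>. finite \<F> \<and> (\<forall>F\<in>\<F>. polytope F \<and> aff_dim F = int DIM('a) - 1) \<and> frontier \<Omega> = \<Union>\<F>)"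

section \<open>Lebesgue and Sobolev spaces\<close>

definition L2 :: "'a::euclidean_space set \<Rightarrow> ('a \<Rightarrow> 'b::euclidean_space) set" where
  "L2 \<Omega> = {f \<in> borel_measurable (lebesgue_on \<Omega>). integrable (lebesgue_on \<Omega>) (\<lambda>x. (norm (f x))\<^sup>2)}"

definition L2_inner ::
  "'a::euclidean_space set \<Rightarrow> ('a \<Rightarrow> 'b::euclidean_space) \<Rightarrow> ('a \<Rightarrow> 'b) \<Rightarrow> real" where
  "L2_inner \<Omega> f g = (\<integral>x. f x \<bullet> g x \<partial>lebesgue_on \<Omega>)"

definition L2_norm :: "'a::euclidean_space set \<Rightarrow> ('a \<Rightarrow> 'b::euclidean_space) \<Rightarrow> real" where
  "L2_norm \<Omega> f = sqrt (L2_inner \<Omega> f f)"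

definition AE_eq :: "'a::euclidean_space set \<Rightarrow> ('a \<Rightarrow> 'b) \<Rightarrow> ('a \<Rightarrow> 'b) \<Rightarrow> bool" where
  "AE_eq \<Omega> f g \<longleftrightarrow> (AE x in lebesgue_on \<Omega>. f x = g x)"

definition AE_nonneg :: "'a::euclidean_space set \<Rightarrow> ('a \<Rightarrow> real) \<Rightarrow> bool" where
  "AE_nonneg \<Omega> v \<longleftrightarrow> (AE x in lebesgue_on \<Omega>. 0 \<le> v x)"

definition partial_deriv :: "'a::euclidean_space \<Rightarrow> ('a \<Rightarrow> real) \<Rightarrow> 'a \<Rightarrow> real" where
  "partial_deriv b f x = frechet_derivative f (at x) b"

text \<open>
  A function is smooth iff all its iterated partial derivatives, including those of order zero,
  are Frechet differentiable everywhere; they are then automatically continuous.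
\<close>

definition smooth :: "('a::euclidean_space \<Rightarrow> real) \<Rightarrow> bool" where
  "smooth f \<longleftrightarrow>
     (\<forall>bs. set bs \<subseteq> Basis \<longrightarrow> (\<forall>x. foldr partial_deriv bs f differentiable at x))"

definition test_functions :: "'a::euclidean_space set \<Rightarrow> ('a \<Rightarrow> real) set" where
  "test_functions \<Omega> =
     {\<phi>. smooth \<phi> \<and> compact (closure {x. \<phi> x \<noteq> 0}) \<and> closure {x. \<phi> x \<noteq> 0} \<subseteq> \<Omega>}"

definition is_weak_grad ::
  "'a::euclidean_space set \<Rightarrow> ('a \<Rightarrow> real) \<Rightarrow> ('a \<Rightarrow> 'a) \<Rightarrow> bool" where
  "is_weak_grad \<Omega> u G \<longleftrightarrow> G \<in> L2 \<Omega> \<and>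
     (\<forall>\<phi>\<in>test_functions \<Omega>. \<forall>b\<in>Basis.
        L2_inner \<Omega> u (partial_deriv b \<phi>) = - L2_inner \<Omega> (\<lambda>x. G x \<bullet> b) \<phi>)"

definition H1 :: "'a::euclidean_space set \<Rightarrow> ('a \<Rightarrow> real) set" where
  "H1 \<Omega> = {u \<in> L2 \<Omega>. \<exists>G. is_weak_grad \<Omega> u G}"

text \<open>On open \<open>\<Omega>\<close>, weak gradients are unique up to null sets.\<close>

definition weak_grad :: "'a::euclidean_space set \<Rightarrow> ('a \<Rightarrow> real) \<Rightarrow> 'a \<Rightarrow> 'a" where
  "weak_grad \<Omega> u = (SOME G. is_weak_grad \<Omega> u G)"

definition H1_norm :: "'a::euclidean_space set \<Rightarrow> ('a \<Rightarrow> real) \<Rightarrow> real" where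
  "H1_norm \<Omega> u = sqrt ((L2_norm \<Omega> u)\<^sup>2 + (L2_norm \<Omega> (weak_grad \<Omega> u))\<^sup>2)"

definition H10 :: "'a::euclidean_space set \<Rightarrow> ('a \<Rightarrow> real) set" where
  "H10 \<Omega> = {u \<in> H1 \<Omega>. \<exists>\<phi>. (\<forall>k::nat. \<phi> k \<in> test_functions \<Omega>) \<and>
                     (\<lambda>k. H1_norm \<Omega> (\<lambda>x. u x - \<phi> k x)) \<longlonglongrightarrow> 0}"

section \<open>The dual space\<close>

text \<open>
  A functional is given by its values on the representatives in \<^term>\<open>H10 \<Omega>\<close>; its values
  elsewhere are irrelevant, so equality of functionals is \<open>dual_eq\<close>. Boundedness forces equal
  values on representatives that agree almost everywhere. The duality pairing is application.
\<close>

definition Hm1 :: "'a::euclidean_space set \<Rightarrow> (('a \<Rightarrow> real) \<Rightarrow> real) set" where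
  "Hm1 \<Omega> = {F.
     (\<forall>v\<in>H10 \<Omega>. \<forall>w\<in>H10 \<Omega>. F (\<lambda>x. v x + w x) = F v + F w) \<and>
     (\<forall>c. \<forall>v\<in>H10 \<Omega>. F (\<lambda>x. c * v x) = c * F v) \<and>
     (\<exists>C. \<forall>v\<in>H10 \<Omega>. \<bar>F v\<bar> \<le> C * H1_norm \<Omega> v)}"

definition dual_eq ::
  "'a::euclidean_space set \<Rightarrow> (('a \<Rightarrow> real) \<Rightarrow> real) \<Rightarrow> (('a \<Rightarrow> real) \<Rightarrow> real) \<Rightarrow> bool" where
  "dual_eq \<Omega> F G \<longleftrightarrow> (\<forall>v\<in>H10 \<Omega>. F v = G v)"

definition dual_nonneg :: "'a::euclidean_space set \<Rightarrow> (('a \<Rightarrow> real) \<Rightarrow> real) \<Rightarrow> bool" where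
  "dual_nonneg \<Omega> F \<longleftrightarrow> (\<forall>v\<in>H10 \<Omega>. AE_nonneg \<Omega> v \<longrightarrow> 0 \<le> F v)"

definition weak_div :: "'a::euclidean_space set \<Rightarrow> ('a \<Rightarrow> 'a) \<Rightarrow> ('a \<Rightarrow> real) \<Rightarrow> real" where
  "weak_div \<Omega> \<sigma> v = - L2_inner \<Omega> \<sigma> (weak_grad \<Omega> v)"

text \<open>
  \<^term>\<open>L2_inner \<Omega> h\<close> is the image of \<open>h\<close> under the embedding of the square-integrable functions
  into the dual space. On open \<open>\<Omega>\<close> this embedding is injective up to null sets, so \<open>L2_density\<close>
  is determined up to null sets.
\<close>

definition dual_in_L2 :: "'a::euclidean_space set \<Rightarrow> (('a \<Rightarrow> real) \<Rightarrow> real) \<Rightarrow> bool" where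
  "dual_in_L2 \<Omega> F \<longleftrightarrow> (\<exists>h\<in>L2 \<Omega>. dual_eq \<Omega> F (L2_inner \<Omega> h))"

definition L2_density ::
  "'a::euclidean_space set \<Rightarrow> (('a \<Rightarrow> real) \<Rightarrow> real) \<Rightarrow> 'a \<Rightarrow> real" where
  "L2_density \<Omega> F = (SOME h. h \<in> L2 \<Omega> \<and> dual_eq \<Omega> F (L2_inner \<Omega> h))"

section \<open>The obstacle problem\<close>

type_synonym 'a triple = "('a \<Rightarrow> real) \<times> ('a \<Rightarrow> 'a) \<times> (('a \<Rightarrow> real) \<Rightarrow> real)"

definition U :: "'a::euclidean_space set \<Rightarrow> 'a triple set" where
  "U \<Omega> = {(u, \<sigma>, l). u \<in> H10 \<Omega> \<and> \<sigma> \<in> L2 \<Omega> \<and> l \<in> Hm1 \<Omega> \<and>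
                    dual_in_L2 \<Omega> (\<lambda>v. weak_div \<Omega> \<sigma> v + l v)}"

definition U_eq :: "'a::euclidean_space set \<Rightarrow> 'a triple \<Rightarrow> 'a triple \<Rightarrow> bool" where
  "U_eq \<Omega> = (\<lambda>(u, \<sigma>, l) (u', \<sigma>', l'). AE_eq \<Omega> u u' \<and> AE_eq \<Omega> \<sigma> \<sigma>' \<and> dual_eq \<Omega> l l')"

definition U_diff :: "'a::euclidean_space triple \<Rightarrow> 'a triple \<Rightarrow> 'a triple" where
  "U_diff = (\<lambda>(u, \<sigma>, l) (u', \<sigma>', l').
     (\<lambda>x. u x - u' x, \<lambda>x. \<sigma> x - \<sigma>' x, \<lambda>v. l v - l' v))"

definition U_norm :: "'a::euclidean_space set \<Rightarrow> 'a triple \<Rightarrow> real" where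
  "U_norm \<Omega> = (\<lambda>(u, \<sigma>, l).
     sqrt ((L2_norm \<Omega> (weak_grad \<Omega> u))\<^sup>2 + (L2_norm \<Omega> \<sigma>)\<^sup>2 +
           (L2_norm \<Omega> (L2_density \<Omega> (\<lambda>v. weak_div \<Omega> \<sigma> v + l v)))\<^sup>2))"

definition Ks :: "'a::euclidean_space set \<Rightarrow> ('a \<Rightarrow> real) \<Rightarrow> 'a triple set" where
  "Ks \<Omega> g = {(u, \<sigma>, l) \<in> U \<Omega>. AE_nonneg \<Omega> (\<lambda>x. u x - g x) \<and> dual_nonneg \<Omega> l}"

definition J :: "'a::euclidean_space set \<Rightarrow> ('a \<Rightarrow> real) \<Rightarrow> ('a \<Rightarrow> real) \<Rightarrow> 'a triple \<Rightarrow> real" where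
  "J \<Omega> f g = (\<lambda>(u, \<sigma>, l).
     (L2_norm \<Omega> (\<lambda>x. L2_density \<Omega> (\<lambda>v. weak_div \<Omega> \<sigma> v + l v) x + f x))\<^sup>2 +
     (L2_norm \<Omega> (\<lambda>x. weak_grad \<Omega> u x - \<sigma> x))\<^sup>2 +
     l (\<lambda>x. u x - g x))"

text \<open>The boundary condition \<open>u = 0\<close> is part of membership in \<^term>\<open>U \<Omega>\<close>.\<close>

definition FO_solution ::
  "'a::euclidean_space set \<Rightarrow> ('a \<Rightarrow> real) \<Rightarrow> ('a \<Rightarrow> real) \<Rightarrow> 'a triple \<Rightarrow> bool" where
  "FO_solution \<Omega> f g = (\<lambda>(u, \<sigma>, l).
     (u, \<sigma>, l) \<in> U \<Omega> \<and>
     dual_eq \<Omega> (\<lambda>v. - weak_div \<Omega> \<sigma> v - l v) (L2_inner \<Omega> f) \<and>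
     AE_eq \<Omega> (\<lambda>x. \<sigma> x - weak_grad \<Omega> u x) (\<lambda>x. 0) \<and>
     AE_nonneg \<Omega> (\<lambda>x. u x - g x) \<and>
     dual_nonneg \<Omega> l \<and>
     l (\<lambda>x. u x - g x) = 0)"

definition LS_solution ::
  "'a::euclidean_space set \<Rightarrow> ('a \<Rightarrow> real) \<Rightarrow> ('a \<Rightarrow> real) \<Rightarrow> 'a triple \<Rightarrow> bool" where
  "LS_solution \<Omega> f g u \<longleftrightarrow> u \<in> Ks \<Omega> g \<and> (\<forall>v\<in>Ks \<Omega> g. J \<Omega> f g u \<le> J \<Omega> f g v)"

end

theory Submission
  imports Defs
begin

text \<open>
  The functional \<open>J\<close> is a sum of three terms that are nonnegative on \<open>K\<^sup>s\<close>: two squared residuals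
  and the complementarity term \<open>\<langle>\<lambda>, u - g\<rangle>\<close>, a nonnegative functional applied to a nonnegative
  function. All three vanish exactly at the solutions of the first-order system
  (\<open>FO_iff_J_eq_0\<close>). Hence the two problems have the same solutions as soon as the system has one,
  for then the minimum of \<open>J\<close> is zero (\<open>FO_iff_LS\<close>).

  A solution of the system comes from the classical obstacle problem. A minimizing sequence of the
  energy \<open>\<parallel>\<nabla>v\<parallel>\<^sup>2 / 2 - (f, v)\<close> over the functions above the obstacle is Cauchy by the parallelogram
  identity, and its limit exists because the space of square-integrable functions is complete
  (\<open>L2_complete\<close>), weak gradients pass to the limit (\<open>H10_closed\<close>), and the gradient controls the
  function itself (\<open>Poincare\<close>). The minimizer \<open>u\<close> satisfies a variational inequality; with
  \<open>\<sigma> = \<nabla>u\<close> and \<open>\<lambda> = - div \<sigma> - f\<close> this says that \<open>\<lambda>\<close> is nonnegative and that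
  \<open>\<langle>\<lambda>, u - g\<rangle> = 0\<close>. The obstacle itself lies in the space with zero boundary values, so that
  \<open>g\<close> and \<open>2 u - g\<close> are competitors.

  For the lower bound let \<open>(w, \<rho>, \<nu>)\<close> be the difference of a competitor and the solution, and let
  \<open>h = div \<rho> + \<nu>\<close>. The residual terms of \<open>J\<close> are \<open>\<parallel>h\<parallel>\<^sup>2\<close> and \<open>\<parallel>\<nabla>w - \<rho>\<parallel>\<^sup>2\<close>, and the complementarity
  term is at least \<open>\<langle>\<nu>, w\<rangle> = (h, w) + (\<rho>, \<nabla>w)\<close>. The part \<open>(\<rho>, \<nabla>w)\<close> compensates half of the mixed
  term \<open>- 2 (\<rho>, \<nabla>w)\<close>. The part \<open>(h, w)\<close> is only bounded by a multiple of \<open>\<parallel>h\<parallel> \<parallel>\<nabla>w\<parallel>\<close> in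
  which the Poincare constant enters and may be large. But the complementarity term is also
  nonnegative, so it may be replaced by a fraction \<open>t\<close> of this lower bound, with \<open>t\<close> small in terms
  of the Poincare constant (\<open>coercive_quadratic\<close>, \<open>coercivity\<close>).

  Uniqueness of weak gradients and of densities of functionals rests on the fundamental lemma of
  the calculus of variations, and thus on a supply of smooth bumps; the bumps are built from
  \<open>exp (- 1 / t)\<close>.
\<close>

section \<open>Square-integrable functions as a complete semi-inner-product space\<close>

lemma L2_measurable: "f \<in> L2 \<Omega> \<Longrightarrow> f \<in> borel_measurable (lebesgue_on \<Omega>)"
  by (simp add: L2_def)

lemma L2_square_integrable: "f \<in> L2 \<Omega> \<Longrightarrow> integrable (lebesgue_on \<Omega>) (\<lambda>x. (norm (f x))\<^sup>2)"
  by (simp add: L2_def)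

lemma L2_bound:
  assumes "h \<in> borel_measurable (lebesgue_on \<Omega>)" "integrable (lebesgue_on \<Omega>) k"
    and "\<And>x. (norm (h x))\<^sup>2 \<le> k x"
  shows "h \<in> L2 \<Omega>"
proof -
  note [measurable] = assms(1)
  have "integrable (lebesgue_on \<Omega>) (\<lambda>x. (norm (h x))\<^sup>2)"
    by (rule Bochner_Integration.integrable_bound[OF assms(2)])
       (use assms(3) in \<open>auto intro: order_trans[OF _ abs_ge_self]\<close>)
  then show ?thesis using assms(1) by (simp add: L2_def)
qed

lemma L2_inner_integrable:
  assumes "f \<in> L2 \<Omega>" "g \<in> L2 \<Omega>"
  shows "integrable (lebesgue_on \<Omega>) (\<lambda>x. f x \<bullet> g x)"
proof -
  note [measurable] = assms[THEN L2_measurable]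
  have *: "norm (f x \<bullet> g x) \<le> norm ((norm (f x))\<^sup>2 + (norm (g x))\<^sup>2)" for x
  proof -
    have "norm (f x \<bullet> g x) \<le> norm (f x) * norm (g x)"
      by (simp add: Cauchy_Schwarz_ineq2)
    also have "\<dots> \<le> (norm (f x))\<^sup>2 + (norm (g x))\<^sup>2"
      using sum_squares_bound[of "norm (f x)" "norm (g x)"]
        mult_nonneg_nonneg[OF norm_ge_zero[of "f x"] norm_ge_zero[of "g x"]]
      unfolding mult.assoc by linarith
    finally show ?thesis by simp
  qed
  show ?thesis
    by (rule Bochner_Integration.integrable_bound
        [where f = "\<lambda>x. (norm (f x))\<^sup>2 + (norm (g x))\<^sup>2"])
       (use assms[THEN L2_square_integrable] * in auto)
qed

lemma L2_add [intro]:
  assumes "f \<in> L2 \<Omega>" "g \<in> L2 \<Omega>"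
  shows "(\<lambda>x. f x + g x) \<in> L2 \<Omega>"
proof (rule L2_bound[where k = "\<lambda>x. 2 * (norm (f x))\<^sup>2 + 2 * (norm (g x))\<^sup>2"])
  note [measurable] = assms[THEN L2_measurable]
  show "(\<lambda>x. f x + g x) \<in> borel_measurable (lebesgue_on \<Omega>)" by measurable
  show "integrable (lebesgue_on \<Omega>) (\<lambda>x. 2 * (norm (f x))\<^sup>2 + 2 * (norm (g x))\<^sup>2)"
    using assms[THEN L2_square_integrable] by auto
  fix x
  have "(norm (f x + g x))\<^sup>2 \<le> (norm (f x) + norm (g x))\<^sup>2"
    by (intro power_mono norm_triangle_ineq) simp
  also have "\<dots> \<le> 2 * (norm (f x))\<^sup>2 + 2 * (norm (g x))\<^sup>2"
    using sum_squares_bound[of "norm (f x)" "norm (g x)"] by (simp add: power2_sum)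
  finally show "(norm (f x + g x))\<^sup>2 \<le> 2 * (norm (f x))\<^sup>2 + 2 * (norm (g x))\<^sup>2" .
qed

lemma L2_scaleR [intro]:
  assumes "f \<in> L2 \<Omega>" shows "(\<lambda>x. c *\<^sub>R f x) \<in> L2 \<Omega>"
proof -
  note [measurable] = assms[THEN L2_measurable]
  show ?thesis
    by (rule L2_bound[where k = "\<lambda>x. c\<^sup>2 * (norm (f x))\<^sup>2"])
       (use assms[THEN L2_square_integrable] in \<open>auto simp: power_mult_distrib\<close>)
qed

lemma L2_mult [intro]: "f \<in> L2 \<Omega> \<Longrightarrow> (\<lambda>x. c * f x :: real) \<in> L2 \<Omega>"
  using L2_scaleR[of f \<Omega> c] by simp

lemma L2_minus [intro]: "f \<in> L2 \<Omega> \<Longrightarrow> (\<lambda>x. - f x) \<in> L2 \<Omega>"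
  using L2_scaleR[of f \<Omega> "-1"] by simp

lemma L2_diff [intro]: "f \<in> L2 \<Omega> \<Longrightarrow> g \<in> L2 \<Omega> \<Longrightarrow> (\<lambda>x. f x - g x) \<in> L2 \<Omega>"
  using L2_add[of f \<Omega> "\<lambda>x. - g x"] L2_minus[of g \<Omega>] by simp

lemma L2_inner_const_right [intro]:
  assumes "f \<in> L2 \<Omega>" shows "(\<lambda>x. f x \<bullet> b) \<in> L2 \<Omega>"
proof -
  note [measurable] = assms[THEN L2_measurable]
  have "(norm (f x \<bullet> b))\<^sup>2 \<le> (norm b)\<^sup>2 * (norm (f x))\<^sup>2" for x
    using power_mono[OF Cauchy_Schwarz_ineq2[of "f x" b], of 2]
    by (simp add: power_mult_distrib mult.commute)
  then show ?thesis
    by (intro L2_bound[where k = "\<lambda>x. (norm b)\<^sup>2 * (norm (f x))\<^sup>2"])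
       (use assms[THEN L2_square_integrable] in auto)
qed

lemma L2_inner_commute: "L2_inner \<Omega> f g = L2_inner \<Omega> g f"
  by (simp add: L2_inner_def inner_commute)

lemma L2_inner_add_left:
  assumes "f \<in> L2 \<Omega>" "g \<in> L2 \<Omega>" "h \<in> L2 \<Omega>"
  shows "L2_inner \<Omega> (\<lambda>x. f x + g x) h = L2_inner \<Omega> f h + L2_inner \<Omega> g h"
  using assms by (simp add: L2_inner_def inner_add_left L2_inner_integrable)

lemma L2_inner_scaleR_left: "L2_inner \<Omega> (\<lambda>x. c *\<^sub>R f x) h = c * L2_inner \<Omega> f h"
  by (simp add: L2_inner_def)

lemma L2_inner_mult_left: "L2_inner \<Omega> (\<lambda>x. c * f x :: real) h = c * L2_inner \<Omega> f h"
  by (simp add: L2_inner_def mult.assoc)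

lemma L2_inner_minus_left: "L2_inner \<Omega> (\<lambda>x. - f x) h = - L2_inner \<Omega> f h"
  by (simp add: L2_inner_def)

lemma L2_inner_diff_left:
  assumes "f \<in> L2 \<Omega>" "g \<in> L2 \<Omega>" "h \<in> L2 \<Omega>"
  shows "L2_inner \<Omega> (\<lambda>x. f x - g x) h = L2_inner \<Omega> f h - L2_inner \<Omega> g h"
  using assms by (simp add: L2_inner_def inner_diff_left L2_inner_integrable)

lemma L2_inner_add_right:
  assumes "f \<in> L2 \<Omega>" "g \<in> L2 \<Omega>" "h \<in> L2 \<Omega>"
  shows "L2_inner \<Omega> h (\<lambda>x. f x + g x) = L2_inner \<Omega> h f + L2_inner \<Omega> h g"
  using L2_inner_add_left[OF assms] by (simp add: L2_inner_commute)

lemma L2_inner_diff_right: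
  assumes "f \<in> L2 \<Omega>" "g \<in> L2 \<Omega>" "h \<in> L2 \<Omega>"
  shows "L2_inner \<Omega> h (\<lambda>x. f x - g x) = L2_inner \<Omega> h f - L2_inner \<Omega> h g"
  using L2_inner_diff_left[OF assms] by (simp add: L2_inner_commute)

lemma L2_inner_scaleR_right: "L2_inner \<Omega> h (\<lambda>x. c *\<^sub>R f x) = c * L2_inner \<Omega> h f"
  by (simp add: L2_inner_def)

lemma L2_inner_mult_right: "L2_inner \<Omega> h (\<lambda>x. c * f x :: real) = c * L2_inner \<Omega> h f"
  by (simp add: L2_inner_def algebra_simps)

lemma L2_inner_minus_right: "L2_inner \<Omega> h (\<lambda>x. - f x) = - L2_inner \<Omega> h f"
  by (simp add: L2_inner_def)

lemmas L2_inner_linear =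
  L2_inner_add_left L2_inner_add_right L2_inner_diff_left L2_inner_diff_right
  L2_inner_scaleR_left L2_inner_scaleR_right L2_inner_mult_left L2_inner_mult_right
  L2_inner_minus_left L2_inner_minus_right

lemma L2_inner_cong:
  assumes "f \<in> L2 \<Omega>" "f' \<in> L2 \<Omega>" "g \<in> L2 \<Omega>" "g' \<in> L2 \<Omega>" "AE_eq \<Omega> f f'" "AE_eq \<Omega> g g'"
  shows "L2_inner \<Omega> f g = L2_inner \<Omega> f' g'"
  unfolding L2_inner_def
proof (rule integral_cong_AE)
  note [measurable] = assms(1-4)[THEN L2_measurable]
  show "(\<lambda>x. f x \<bullet> g x) \<in> borel_measurable (lebesgue_on \<Omega>)"
       "(\<lambda>x. f' x \<bullet> g' x) \<in> borel_measurable (lebesgue_on \<Omega>)" by measurable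
  show "AE x in lebesgue_on \<Omega>. f x \<bullet> g x = f' x \<bullet> g' x"
    using assms(5,6) unfolding AE_eq_def by eventually_elim simp
qed

lemma L2_inner_self_nonneg: "0 \<le> L2_inner \<Omega> f f"
  by (simp add: L2_inner_def)

lemma L2_norm_nonneg [simp]: "0 \<le> L2_norm \<Omega> f"
  by (simp add: L2_norm_def L2_inner_self_nonneg)

lemma L2_norm_square: "(L2_norm \<Omega> f)\<^sup>2 = L2_inner \<Omega> f f"
  by (simp add: L2_norm_def L2_inner_self_nonneg)

lemma L2_norm_square_integral: "(L2_norm \<Omega> f)\<^sup>2 = (\<integral>x. (norm (f x))\<^sup>2 \<partial>lebesgue_on \<Omega>)"
  by (simp add: L2_norm_square L2_inner_def dot_square_norm)

lemma L2_norm_cong: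
  assumes "f \<in> L2 \<Omega>" "f' \<in> L2 \<Omega>" "AE_eq \<Omega> f f'"
  shows "L2_norm \<Omega> f = L2_norm \<Omega> f'"
  unfolding L2_norm_def using L2_inner_cong[OF assms(1,2,1,2,3,3)] by simp

lemma L2_norm_scaleR: "L2_norm \<Omega> (\<lambda>x. c *\<^sub>R f x) = \<bar>c\<bar> * L2_norm \<Omega> f"
  by (simp add: L2_norm_def L2_inner_scaleR_left L2_inner_scaleR_right real_sqrt_mult
        mult.assoc[symmetric])

lemma L2_norm_minus: "L2_norm \<Omega> (\<lambda>x. - f x) = L2_norm \<Omega> f"
  by (simp add: L2_norm_def L2_inner_def)

lemma L2_norm_minus_commute: "L2_norm \<Omega> (\<lambda>x. f x - g x) = L2_norm \<Omega> (\<lambda>x. g x - f x)"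
  using L2_norm_minus[of \<Omega> "\<lambda>x. f x - g x"] by simp

lemma L2_norm_square_add:
  assumes "f \<in> L2 \<Omega>" "g \<in> L2 \<Omega>"
  shows "(L2_norm \<Omega> (\<lambda>x. f x + g x))\<^sup>2
    = (L2_norm \<Omega> f)\<^sup>2 + 2 * L2_inner \<Omega> f g + (L2_norm \<Omega> g)\<^sup>2"
  using assms by (simp add: L2_norm_square L2_inner_linear L2_add L2_inner_commute[of \<Omega> g f])

lemma L2_norm_square_diff:
  assumes "f \<in> L2 \<Omega>" "g \<in> L2 \<Omega>"
  shows "(L2_norm \<Omega> (\<lambda>x. f x - g x))\<^sup>2
    = (L2_norm \<Omega> f)\<^sup>2 - 2 * L2_inner \<Omega> f g + (L2_norm \<Omega> g)\<^sup>2"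
  using assms by (simp add: L2_norm_square L2_inner_linear L2_diff L2_inner_commute[of \<Omega> g f])

text \<open>
  A quadratic polynomial in \<open>t\<close> without sign change has a nonpositive discriminant.
\<close>
lemma discriminant_bound:
  fixes A B C :: real
  assumes nonneg: "\<And>t. 0 \<le> A - 2 * t * B + t\<^sup>2 * C" and "0 \<le> C"
  shows "B\<^sup>2 \<le> A * C"
proof (cases "C = 0")
  case True
  have "B = 0"
  proof (rule ccontr)
    assume "B \<noteq> 0"
    then show False using nonneg[of "(A + 1) / (2 * B)"] True by simp
  qed
  then show ?thesis using True by simp
next
  case False
  then have "0 < C" using assms(2) by simp
  have "0 \<le> A - 2 * (B / C) * B + (B / C)\<^sup>2 * C" by (rule nonneg)
  also have "\<dots> = A - B\<^sup>2 / C" using \<open>0 < C\<close> by (simp add: power2_eq_square)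
  finally show ?thesis using \<open>0 < C\<close> by (simp add: field_simps)
qed

lemma L2_Cauchy_Schwarz:
  assumes "f \<in> L2 \<Omega>" "g \<in> L2 \<Omega>"
  shows "\<bar>L2_inner \<Omega> f g\<bar> \<le> L2_norm \<Omega> f * L2_norm \<Omega> g"
proof -
  have "0 \<le> (L2_norm \<Omega> f)\<^sup>2 - 2 * t * L2_inner \<Omega> f g + t\<^sup>2 * (L2_norm \<Omega> g)\<^sup>2" for t
    using L2_norm_square_diff[OF assms(1) L2_scaleR[OF assms(2), of t]]
      zero_le_power2[of "L2_norm \<Omega> (\<lambda>x. f x - t *\<^sub>R g x)"]
    by (simp add: L2_inner_scaleR_right L2_norm_scaleR power_mult_distrib mult.assoc)
  from discriminant_bound[OF this]
  have "(L2_inner \<Omega> f g)\<^sup>2 \<le> (L2_norm \<Omega> f * L2_norm \<Omega> g)\<^sup>2" by (simp add: power_mult_distrib)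
  then have "\<bar>L2_inner \<Omega> f g\<bar> \<le> \<bar>L2_norm \<Omega> f * L2_norm \<Omega> g\<bar>"
    by (simp only: abs_le_square_iff)
  then show ?thesis by (simp add: abs_mult)
qed

lemma L2_norm_triangle:
  assumes "f \<in> L2 \<Omega>" "g \<in> L2 \<Omega>"
  shows "L2_norm \<Omega> (\<lambda>x. f x + g x) \<le> L2_norm \<Omega> f + L2_norm \<Omega> g"
proof (rule power2_le_imp_le)
  show "(L2_norm \<Omega> (\<lambda>x. f x + g x))\<^sup>2 \<le> (L2_norm \<Omega> f + L2_norm \<Omega> g)\<^sup>2"
    using L2_norm_square_add[OF assms] L2_Cauchy_Schwarz[OF assms] by (auto simp: power2_sum)
qed simp

lemma L2_norm_triangle_sub:
  assumes "f \<in> L2 \<Omega>" "g \<in> L2 \<Omega>"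
  shows "L2_norm \<Omega> f \<le> L2_norm \<Omega> g + L2_norm \<Omega> (\<lambda>x. f x - g x)"
  using L2_norm_triangle[OF assms(2) L2_diff[OF assms]] by simp

lemma L2_norm_eq_0_iff:
  assumes "f \<in> L2 \<Omega>"
  shows "L2_norm \<Omega> f = 0 \<longleftrightarrow> (AE x in lebesgue_on \<Omega>. f x = 0)"
proof -
  have "L2_norm \<Omega> f = 0 \<longleftrightarrow> (\<integral>x. (norm (f x))\<^sup>2 \<partial>lebesgue_on \<Omega>) = 0"
    unfolding L2_norm_square_integral[symmetric] by simp
  also have "\<dots> \<longleftrightarrow> (AE x in lebesgue_on \<Omega>. (norm (f x))\<^sup>2 = 0)"
    using integral_nonneg_eq_0_iff_AE[OF L2_square_integrable[OF assms]] by simp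
  finally show ?thesis by simp
qed

lemma L2_norm_diff_eq_0_imp_AE_eq:
  assumes "f \<in> L2 \<Omega>" "g \<in> L2 \<Omega>" "L2_norm \<Omega> (\<lambda>x. f x - g x) = 0"
  shows "AE_eq \<Omega> f g"
  using L2_norm_eq_0_iff[OF L2_diff[OF assms(1,2)]] assms(3) by (simp add: AE_eq_def)

lemma L2_inner_tendsto:
  assumes f: "\<And>n. f n \<in> L2 \<Omega>" "F \<in> L2 \<Omega>" "(\<lambda>n::nat. L2_norm \<Omega> (\<lambda>x. f n x - F x)) \<longlonglongrightarrow> 0"
    and g: "g \<in> L2 \<Omega>"
  shows "(\<lambda>n. L2_inner \<Omega> (f n) g) \<longlonglongrightarrow> L2_inner \<Omega> F g"
proof (rule LIM_zero_cancel, rule Lim_null_comparison)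
  show "\<forall>\<^sub>F n in sequentially. norm (L2_inner \<Omega> (f n) g - L2_inner \<Omega> F g)
      \<le> L2_norm \<Omega> (\<lambda>x. f n x - F x) * L2_norm \<Omega> g"
    using L2_Cauchy_Schwarz[OF L2_diff[OF f(1,2)] g] by (simp add: L2_inner_diff_left f g)
  show "(\<lambda>n. L2_norm \<Omega> (\<lambda>x. f n x - F x) * L2_norm \<Omega> g) \<longlonglongrightarrow> 0"
    using tendsto_mult_right[OF f(3), of "L2_norm \<Omega> g"] by simp
qed

lemma L2_norm_tendsto:
  assumes f: "\<And>n. f n \<in> L2 \<Omega>" "F \<in> L2 \<Omega>" "(\<lambda>n::nat. L2_norm \<Omega> (\<lambda>x. f n x - F x)) \<longlonglongrightarrow> 0"
  shows "(\<lambda>n. L2_norm \<Omega> (f n)) \<longlonglongrightarrow> L2_norm \<Omega> F"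
proof (rule LIM_zero_cancel, rule Lim_null_comparison)
  show "\<forall>\<^sub>F n in sequentially. norm (L2_norm \<Omega> (f n) - L2_norm \<Omega> F)
      \<le> L2_norm \<Omega> (\<lambda>x. f n x - F x)"
    using L2_norm_triangle_sub[OF f(1,2)] L2_norm_triangle_sub[OF f(2,1)]
    by (intro always_eventually allI) (simp add: abs_le_iff L2_norm_minus_commute[of \<Omega> F] algebra_simps)
qed (rule f(3))

lemma L2_const: "\<Omega> \<in> lmeasurable \<Longrightarrow> (\<lambda>x. c) \<in> L2 \<Omega>"
  using finite_measure.integrable_const[OF finite_measure_lebesgue_on]
  by (auto simp: L2_def)

text \<open>Finite measure gives access to the convergence theorems for integrable functions.\<close>

lemma L2_integrable:
  assumes "\<Omega> \<in> lmeasurable" "f \<in> L2 \<Omega>"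
  shows "integrable (lebesgue_on \<Omega>) f"
proof -
  note [measurable] = assms(2)[THEN L2_measurable]
  have "norm (f x) \<le> 1 + (norm (f x))\<^sup>2" for x
    using sum_squares_bound[of "norm (f x)" 1] norm_ge_zero[of "f x"] by (auto intro: order_trans[of _ "2 * norm (f x)"])
  then have "norm (f x) \<le> norm (1 + (norm (f x))\<^sup>2)" for x
    by simp 
  moreover have "integrable (lebesgue_on \<Omega>) (\<lambda>x. 1 + (norm (f x))\<^sup>2)"
    by (intro Bochner_Integration.integrable_add L2_square_integrable assms(2)
        finite_measure.integrable_const finite_measure_lebesgue_on assms(1))
  ultimately show ?thesis
    using Bochner_Integration.integrable_bound[of "lebesgue_on \<Omega>" "\<lambda>x. 1 + (norm (f x))\<^sup>2" f]
      assms(2)[THEN L2_measurable] by simp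
qed

lemma L2_norm_L1_bound:
  assumes "\<Omega> \<in> lmeasurable" "f \<in> L2 \<Omega>"
  shows "(\<integral>x. norm (f x) \<partial>lebesgue_on \<Omega>) \<le> L2_norm \<Omega> f * L2_norm \<Omega> (\<lambda>x. 1 :: real)"
proof -
  note [measurable] = assms(2)[THEN L2_measurable]
  have f: "(\<lambda>x. norm (f x)) \<in> L2 \<Omega>" using assms(2) by (auto simp: L2_def)
  have "(\<integral>x. norm (f x) \<partial>lebesgue_on \<Omega>) = L2_inner \<Omega> (\<lambda>x. norm (f x)) (\<lambda>x. 1)"
    by (simp add: L2_inner_def)
  also have "\<dots> \<le> L2_norm \<Omega> (\<lambda>x. norm (f x)) * L2_norm \<Omega> (\<lambda>x. 1 :: real)"
    using L2_Cauchy_Schwarz[OF f L2_const[OF assms(1)], of 1] by linarith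
  also have "L2_norm \<Omega> (\<lambda>x. norm (f x)) = L2_norm \<Omega> f"
    by (simp add: L2_norm_def L2_inner_def dot_square_norm power2_eq_square)
  finally show ?thesis .
qed

text \<open>
  By monotone convergence the sum of the norms has a finite integral, so it is finite almost everywhere.
\<close>
lemma AE_summable_norm:
  fixes d :: "nat \<Rightarrow> 'a \<Rightarrow> 'b::{banach, second_countable_topology}"
  assumes d: "\<And>k. integrable M (d k)" and "summable (\<lambda>k. \<integral>x. norm (d k x) \<partial>M)"
  shows "AE x in M. summable (\<lambda>k. norm (d k x))"
proof -
  note [measurable] = borel_measurable_integrable[OF d]
  have "(\<integral>\<^sup>+x. (\<Sum>k. ennreal (norm (d k x))) \<partial>M) = (\<Sum>k. \<integral>\<^sup>+x. ennreal (norm (d k x)) \<partial>M)"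
    by (rule nn_integral_suminf) measurable
  also have "\<dots> = (\<Sum>k. ennreal (\<integral>x. norm (d k x) \<partial>M))"
    using d by (intro suminf_cong nn_integral_eq_integral) auto
  also have "\<dots> \<noteq> \<infinity>"
    using assms(2) by (subst suminf_ennreal2) auto
  finally have "AE x in M. (\<Sum>k. ennreal (norm (d k x))) \<noteq> \<infinity>"
    by (intro nn_integral_PInf_AE) auto
  then show ?thesis
    by eventually_elim (auto intro: summable_suminf_not_top)
qed

text \<open>
  Fatou's lemma is stated for nonnegative integrals; this passes between the two.
\<close>
lemma nn_integral_L2_norm:
  "f \<in> L2 \<Omega> \<Longrightarrow> (\<integral>\<^sup>+x. ennreal ((norm (f x))\<^sup>2) \<partial>lebesgue_on \<Omega>) = ennreal ((L2_norm \<Omega> f)\<^sup>2)"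
  by (simp add: L2_norm_square_integral nn_integral_eq_integral L2_square_integrable)

text \<open>
  A subsequence whose consecutive differences are summable in norm converges almost everywhere,
  and Fatou's lemma shows that the pointwise limit is also the limit in norm of the whole sequence.
\<close>

theorem L2_complete:
  fixes f :: "nat \<Rightarrow> 'a::euclidean_space \<Rightarrow> 'b::euclidean_space"
  assumes \<Omega>: "\<Omega> \<in> lmeasurable" and f: "\<And>n. f n \<in> L2 \<Omega>"
    and Cauchy: "\<And>e. 0 < e \<Longrightarrow> \<exists>N. \<forall>m\<ge>N. \<forall>n\<ge>N. L2_norm \<Omega> (\<lambda>x. f m x - f n x) < e"
  obtains F where "F \<in> L2 \<Omega>" "(\<lambda>n. L2_norm \<Omega> (\<lambda>x. f n x - F x)) \<longlonglongrightarrow> 0"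
proof -
  note [measurable] = f[THEN L2_measurable]
  define Q where "Q k N \<longleftrightarrow> (\<forall>m\<ge>N. \<forall>n\<ge>N. L2_norm \<Omega> (\<lambda>x. f m x - f n x) < (1/2)^k)" for k N :: nat
  have "\<exists>N. Q k N" for k
    unfolding Q_def by (rule Cauchy) simp
  then obtain N :: "nat \<Rightarrow> nat" where "\<And>k. Q k (N k)" by metis
  then have N: "L2_norm \<Omega> (\<lambda>x. f m x - f n x) < (1/2)^k" if "m \<ge> N k" "n \<ge> N k" for k m n
    unfolding Q_def using that by blast
  \<comment> \<open>Partial sums make the chosen indices increasing and keep them above \<open>N k\<close>.\<close>
  define s where "s k = (\<Sum>j\<le>k. N j)" for k
  have s_ge: "N k \<le> s k" and s_Suc: "s k \<le> s (Suc k)" for k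
    unfolding s_def by (auto intro: member_le_sum)
  have s_mono: "s j \<le> s k" if "j \<le> k" for j k
    using lift_Suc_mono_le[of s, OF s_Suc that] .
  define d where "d k x = f (s (Suc k)) x - f (s k) x" for k x
  have d: "d k \<in> L2 \<Omega>" for k unfolding d_def by (intro L2_diff f)
  have norm_d: "L2_norm \<Omega> (d k) \<le> (1/2)^k" for k
    using N[of k "s (Suc k)" "s k"] s_ge[of k] s_Suc[of k] unfolding d_def by force
  have "summable (\<lambda>k. \<integral>x. norm (d k x) \<partial>lebesgue_on \<Omega>)"
  proof (rule summable_comparison_test_ev)
    show "\<forall>\<^sub>F k in sequentially. norm (\<integral>x. norm (d k x) \<partial>lebesgue_on \<Omega>)
        \<le> (1/2)^k * L2_norm \<Omega> (\<lambda>x. 1 :: real)"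
    proof (intro always_eventually allI)
      fix k
      have "norm (\<integral>x. norm (d k x) \<partial>lebesgue_on \<Omega>) \<le> L2_norm \<Omega> (d k) * L2_norm \<Omega> (\<lambda>x. 1 :: real)"
        using L2_norm_L1_bound[OF \<Omega> d[of k]] by simp
      also have "\<dots> \<le> (1/2)^k * L2_norm \<Omega> (\<lambda>x. 1 :: real)"
        by (intro mult_right_mono norm_d) simp
      finally show "norm (\<integral>x. norm (d k x) \<partial>lebesgue_on \<Omega>) \<le> (1/2)^k * L2_norm \<Omega> (\<lambda>x. 1 :: real)" .
    qed
    show "summable (\<lambda>k. (1/2)^k * L2_norm \<Omega> (\<lambda>x. 1 :: real))"
      by (intro summable_mult2 summable_geometric) simp
  qed
  then have "AE x in lebesgue_on \<Omega>. summable (\<lambda>k. norm (d k x))"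
    by (intro AE_summable_norm L2_integrable[OF \<Omega> d])
  then have conv: "AE x in lebesgue_on \<Omega>. (\<lambda>k. f (s k) x) \<longlonglongrightarrow> lim (\<lambda>k. f (s k) x)"
  proof eventually_elim
    case (elim x)
    then have "summable (\<lambda>k. d k x)" by (rule summable_norm_cancel)
    then have "convergent (\<lambda>n. \<Sum>k<n. d k x)" by (simp add: summable_iff_convergent)
    moreover have "(\<Sum>k<n. d k x) = f (s n) x - f (s 0) x" for n
      unfolding d_def by (rule sum_lessThan_telescope)
    ultimately have "convergent (\<lambda>n. (f (s n) x - f (s 0) x) + f (s 0) x)"
      by (intro convergent_add convergent_const) simp
    then show ?case by (simp add: convergent_LIMSEQ_iff)
  qed
  define F where "F x = lim (\<lambda>k. f (s k) x)" for x
  have [measurable]: "F \<in> borel_measurable (lebesgue_on \<Omega>)" unfolding F_def by measurable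
  have Fatou: "(\<integral>\<^sup>+x. ennreal ((norm (f n x - F x))\<^sup>2) \<partial>lebesgue_on \<Omega>) \<le> ennreal (e\<^sup>2)"
    if "0 < e" and M: "\<And>m. m \<ge> M \<Longrightarrow> L2_norm \<Omega> (\<lambda>x. f n x - f (s m) x) \<le> e" for n M e
  proof -
    have "(\<integral>\<^sup>+x. ennreal ((norm (f n x - F x))\<^sup>2) \<partial>lebesgue_on \<Omega>)
        = (\<integral>\<^sup>+x. liminf (\<lambda>k. ennreal ((norm (f n x - f (s k) x))\<^sup>2)) \<partial>lebesgue_on \<Omega>)"
    proof (rule nn_integral_cong_AE)
      show "AE x in lebesgue_on \<Omega>. ennreal ((norm (f n x - F x))\<^sup>2)
          = liminf (\<lambda>k. ennreal ((norm (f n x - f (s k) x))\<^sup>2))"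
        using conv
      proof eventually_elim
        case (elim x)
        then have "(\<lambda>k. ennreal ((norm (f n x - f (s k) x))\<^sup>2)) \<longlonglongrightarrow> ennreal ((norm (f n x - F x))\<^sup>2)"
          unfolding F_def by (intro tendsto_intros)
        then show ?case using lim_imp_Liminf[OF sequentially_bot] by metis
      qed
    qed
    also have "\<dots> \<le> liminf (\<lambda>k. \<integral>\<^sup>+x. ennreal ((norm (f n x - f (s k) x))\<^sup>2) \<partial>lebesgue_on \<Omega>)"
      by (rule nn_integral_liminf) measurable
    also have "\<dots> = liminf (\<lambda>k. ennreal ((L2_norm \<Omega> (\<lambda>x. f n x - f (s k) x))\<^sup>2))"
      using nn_integral_L2_norm[OF L2_diff[OF f f]] by simp
    also have "\<dots> \<le> ennreal (e\<^sup>2)"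
    proof (rule Liminf_le)
      have "ennreal ((L2_norm \<Omega> (\<lambda>x. f n x - f (s k) x))\<^sup>2) \<le> ennreal (e\<^sup>2)" if "k \<ge> M" for k
        using M[OF that] by (intro ennreal_leI power_mono) auto
      then show "\<forall>\<^sub>F k in sequentially. ennreal ((L2_norm \<Omega> (\<lambda>x. f n x - f (s k) x))\<^sup>2) \<le> ennreal (e\<^sup>2)"
        using eventually_sequentially by blast
    qed simp
    finally show ?thesis .
  qed
  have ev: "\<exists>K. \<forall>n\<ge>K. (\<lambda>x. f n x - F x) \<in> L2 \<Omega> \<and> L2_norm \<Omega> (\<lambda>x. f n x - F x) \<le> e" if "0 < e" for e
  proof -
    obtain k where k: "(1/2)^k < e"
      using real_arch_pow_inv[OF \<open>0 < e\<close>, of "1/2"] by auto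
    have "(\<lambda>x. f n x - F x) \<in> L2 \<Omega> \<and> L2_norm \<Omega> (\<lambda>x. f n x - F x) \<le> e" if "n \<ge> N k" for n
    proof -
      have "L2_norm \<Omega> (\<lambda>x. f n x - f (s m) x) \<le> e" if "m \<ge> k" for m
        using N[of k n "s m"] \<open>n \<ge> N k\<close> s_ge[of k] s_mono[OF that] k by force
      from Fatou[OF \<open>0 < e\<close> this]
      have le: "(\<integral>\<^sup>+x. ennreal ((norm (f n x - F x))\<^sup>2) \<partial>lebesgue_on \<Omega>) \<le> ennreal (e\<^sup>2)" .
      have "integrable (lebesgue_on \<Omega>) (\<lambda>x. (norm (f n x - F x))\<^sup>2)"
        using le_less_trans[OF le ennreal_less_top] by (intro integrableI_nonneg) auto
      then have mem: "(\<lambda>x. f n x - F x) \<in> L2 \<Omega>" by (simp add: L2_def)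
      have "(L2_norm \<Omega> (\<lambda>x. f n x - F x))\<^sup>2 \<le> e\<^sup>2"
        using le unfolding nn_integral_L2_norm[OF mem] by simp
      from power2_le_imp_le[OF this] show ?thesis using mem \<open>0 < e\<close> by simp
    qed
    then show ?thesis by blast
  qed
  have "F \<in> L2 \<Omega>"
  proof -
    obtain K where "(\<lambda>x. f K x - F x) \<in> L2 \<Omega>" using ev[of 1] by auto
    from L2_diff[OF f[of K] this] show ?thesis by simp
  qed
  moreover have "(\<lambda>n. L2_norm \<Omega> (\<lambda>x. f n x - F x)) \<longlonglongrightarrow> 0"
  proof (rule LIMSEQ_I)
    fix r :: real assume "0 < r"
    then obtain K where "\<forall>n\<ge>K. L2_norm \<Omega> (\<lambda>x. f n x - F x) \<le> r / 2" using ev[of "r/2"] by auto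
    then show "\<exists>no. \<forall>n\<ge>no. norm (L2_norm \<Omega> (\<lambda>x. f n x - F x) - 0) < r"
      using \<open>0 < r\<close> by (intro exI[of _ K]) force
  qed
  ultimately show ?thesis by (rule that)
qed

section \<open>Test functions\<close>

subsection \<open>Smoothness\<close>

lemma partial_deriv_eq:
  "(f has_derivative f') (at x) \<Longrightarrow> partial_deriv b f x = f' b"
  by (simp add: partial_deriv_def frechet_derivative_at[symmetric])

text \<open>
  Iterated derivatives never leave a set of differentiable functions that is closed under the
  first partial derivatives.
\<close>
lemma smooth_coinduct:
  assumes "f \<in> S"
    and diff: "\<And>f x. f \<in> S \<Longrightarrow> f differentiable at x"
    and step: "\<And>f b. f \<in> S \<Longrightarrow> b \<in> Basis \<Longrightarrow> partial_deriv b f \<in> S"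
  shows "smooth f"
proof -
  have "foldr partial_deriv bs f \<in> S" if "set bs \<subseteq> Basis" for bs
    using that by (induction bs) (auto intro: step \<open>f \<in> S\<close>)
  then show ?thesis unfolding smooth_def using diff by blast
qed

lemma smooth_differentiable: "smooth f \<Longrightarrow> f differentiable at x"
  unfolding smooth_def by (drule spec[of _ "[]"]) simp

lemma smooth_has_derivative: "smooth f \<Longrightarrow> (f has_derivative frechet_derivative f (at x)) (at x)"
  using smooth_differentiable frechet_derivative_works by blast

lemma smooth_partial_deriv:
  assumes "smooth f" "b \<in> Basis" shows "smooth (partial_deriv b f)"
  unfolding smooth_def
proof (intro allI impI)
  fix bs :: "'a list" and x assume "set bs \<subseteq> Basis"
  \<comment> \<open>The innermost derivative is the last entry of the list.\<close>
  then have "foldr partial_deriv (bs @ [b]) f differentiable at x"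
    using assms unfolding smooth_def by (intro assms(1)[unfolded smooth_def, rule_format]) simp
  then show "foldr partial_deriv bs (partial_deriv b f) differentiable at x" by simp
qed

lemma smooth_continuous_on: "smooth f \<Longrightarrow> continuous_on S f"
  by (meson smooth_differentiable continuous_at_imp_continuous_on differentiable_imp_continuous_within)

lemma smooth_borel_measurable: "smooth f \<Longrightarrow> f \<in> borel_measurable borel"
  by (intro borel_measurable_continuous_onI smooth_continuous_on)

text \<open>
  The function \<open>exp (- 1 / t)\<close>, extended by zero, is smooth but not analytic at zero. The factor
  \<open>1 / t ^ n\<close> makes the family closed, up to linear combinations, under differentiation.
\<close>

definition flat :: "nat \<Rightarrow> real \<Rightarrow> real" where
  "flat n t = (if 0 < t then exp (- 1 / t) / t ^ n else 0)"

lemma flat_pos_iff: "flat 0 t \<noteq> 0 \<longleftrightarrow> 0 < t"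
  by (simp add: flat_def)

lemma flat_0_bounds: "0 \<le> flat 0 t" "flat 0 t \<le> 1"
  by (auto simp: flat_def)

text \<open>
  With \<open>y = 1 / t\<close> this is the decay of \<open>y ^ n * exp (- y)\<close> at infinity.
\<close>
lemma flat_tendsto_0: "(flat n \<longlongrightarrow> 0) (at_right 0)"
proof -
  have "((\<lambda>t. inverse t ^ n / exp (inverse t)) \<longlongrightarrow> (0::real)) (at_right 0)"
    by (rule filterlim_compose[OF tendsto_power_div_exp_0 filterlim_inverse_at_top_right])
  moreover have "\<forall>\<^sub>F t in at_right (0::real). inverse t ^ n / exp (inverse t) = flat n t"
    by (auto simp: eventually_at_right_less flat_def exp_minus field_simps
        intro!: eventually_at_rightI[of 0 1])
  ultimately show ?thesis by (rule Lim_transform_eventually)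
qed

lemma DERIV_flat: "(flat n has_real_derivative flat (n + 2) t - real n * flat (n + 1) t) (at t)"
proof (cases t "0 :: real" rule: linorder_cases)
  case less
  have "((\<lambda>t. 0) has_real_derivative 0) (at t)" by simp
  then have "(flat n has_real_derivative 0) (at t)"
    by (rule has_field_derivative_transform_within_open[of _ _ _ "{..<0}"])
       (use less in \<open>auto simp: flat_def\<close>)
  then show ?thesis using less by (simp add: flat_def)
next
  case greater
  have "((\<lambda>t. exp (- 1 / t) / t ^ n) has_real_derivative
      flat (n + 2) t - real n * flat (n + 1) t) (at t)"
  proof -
    have power: "((\<lambda>t. t ^ n) has_real_derivative real n * (t ^ n / t)) (at t)"
      using DERIV_pow[of n t UNIV] greater by (cases n) auto
    have exp: "((\<lambda>t. exp (- 1 / t)) has_real_derivative exp (- 1 / t) / t\<^sup>2) (at t)"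
      using greater by (auto intro!: derivative_eq_intros simp: power2_eq_square)
    show ?thesis
      by (rule DERIV_cong[OF DERIV_divide[OF exp power]])
         (use greater in \<open>auto simp: flat_def field_simps power2_eq_square\<close>)
  qed
  then show ?thesis
    by (rule has_field_derivative_transform_within_open[of _ _ _ "{0<..}"])
       (use greater in \<open>auto simp: flat_def\<close>)
next
  case equal
  have "((\<lambda>h. flat n h / h) \<longlongrightarrow> 0) (at 0)"
  proof (rule filterlim_split_at)
    have "\<forall>\<^sub>F h in at_left (0::real). 0 = flat n h / h"
      by (rule eventually_at_leftI[of "-1"]) (auto simp: flat_def)
    then show "((\<lambda>h. flat n h / h) \<longlongrightarrow> 0) (at_left 0)"
      by (rule Lim_transform_eventually[OF tendsto_const])
    \<comment> \<open>Dividing by \<open>h\<close> raises the index, and every member of the family tends to zero.\<close>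
    have "\<forall>\<^sub>F h in at_right (0::real). flat (n + 1) h = flat n h / h"
      by (rule eventually_at_rightI[of 0 1]) (auto simp: flat_def)
    then show "((\<lambda>h. flat n h / h) \<longlongrightarrow> 0) (at_right 0)"
      by (rule Lim_transform_eventually[OF flat_tendsto_0])
  qed
  then show ?thesis using equal by (simp add: has_field_derivative_iff flat_def)
qed

text \<open>
  One inductive set that contains the smooth functions and the building blocks of the bumps, and
  is closed under sums and products, yields at once that all of these are smooth.
\<close>
inductive_set smooth_ring :: "('a::euclidean_space \<Rightarrow> real) set" where
  base: "smooth f \<Longrightarrow> f \<in> smooth_ring"
| const: "(\<lambda>x. c) \<in> smooth_ring"
| linear: "(\<lambda>x. x \<bullet> v) \<in> smooth_ring"
| flat: "(\<lambda>x. flat n (x \<bullet> v + c)) \<in> smooth_ring"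
| add: "f \<in> smooth_ring \<Longrightarrow> g \<in> smooth_ring \<Longrightarrow> (\<lambda>x. f x + g x) \<in> smooth_ring"
| mult: "f \<in> smooth_ring \<Longrightarrow> g \<in> smooth_ring \<Longrightarrow> (\<lambda>x. f x * g x) \<in> smooth_ring"

lemma smooth_ring_derivative:
  assumes "f \<in> smooth_ring"
  shows "\<exists>f'. (\<forall>x. (f has_derivative f' x) (at x)) \<and> (\<forall>b\<in>Basis. (\<lambda>x. f' x b) \<in> smooth_ring)"
  using assms
proof induction
  case (base f)
  have "\<forall>b\<in>Basis. (\<lambda>x. frechet_derivative f (at x) b) \<in> smooth_ring"
    using smooth_partial_deriv[OF base, THEN smooth_ring.base] by (simp add: partial_deriv_def[abs_def])
  then show ?case using smooth_has_derivative[OF base]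
    by (intro exI[of _ "\<lambda>x. frechet_derivative f (at x)"]) simp
next
  case (const c)
  show ?case by (intro exI[of _ "\<lambda>x h. 0"]) (auto intro: smooth_ring.const)
next
  case (linear v)
  show ?case by (intro exI[of _ "\<lambda>x h. h \<bullet> v"])
      (auto intro: smooth_ring.const has_derivative_inner_left has_derivative_ident)
next
  case (flat n v c)
  define f' where "f' x h = (h \<bullet> v) * (flat (n + 2) (x \<bullet> v + c) - real n * flat (n + 1) (x \<bullet> v + c))"
    for x h :: 'a
  have "((\<lambda>x. flat n (x \<bullet> v + c)) has_derivative f' x) (at x)" for x
  proof -
    have "((\<lambda>x. x \<bullet> v + c) has_derivative (\<lambda>h. h \<bullet> v)) (at x)"
      by (auto intro!: derivative_eq_intros)
    from has_derivative_compose[OF this DERIV_flat[unfolded has_field_derivative_def]]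
    show ?thesis unfolding f'_def by (simp add: mult.commute)
  qed
  moreover have "(\<lambda>x. f' x b) \<in> smooth_ring" for b
  proof -
    have "(\<lambda>x. (b \<bullet> v) * (flat (n + 2) (x \<bullet> v + c) + (- real n) * flat (n + 1) (x \<bullet> v + c)))
        \<in> smooth_ring"
      by (intro smooth_ring.mult smooth_ring.add smooth_ring.const smooth_ring.flat)
    then show ?thesis unfolding f'_def by simp
  qed
  ultimately show ?case by blast
next
  case (add f g)
  then obtain f' g' where
    "\<forall>x. (f has_derivative f' x) (at x)" "\<forall>b\<in>Basis. (\<lambda>x. f' x b) \<in> smooth_ring"
    "\<forall>x. (g has_derivative g' x) (at x)" "\<forall>b\<in>Basis. (\<lambda>x. g' x b) \<in> smooth_ring" by blast
  then show ?case
    by (intro exI[of _ "\<lambda>x h. f' x h + g' x h"]) (auto intro: smooth_ring.add has_derivative_add)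
next
  case (mult f g)
  then obtain f' g' where
    "\<forall>x. (f has_derivative f' x) (at x)" "\<forall>b\<in>Basis. (\<lambda>x. f' x b) \<in> smooth_ring"
    "\<forall>x. (g has_derivative g' x) (at x)" "\<forall>b\<in>Basis. (\<lambda>x. g' x b) \<in> smooth_ring" by blast
  then show ?case using mult
    by (intro exI[of _ "\<lambda>x h. f x * g' x h + f' x h * g x"] conjI allI ballI
        smooth_ring.add smooth_ring.mult has_derivative_mult) auto
qed

lemma smooth_ring_smooth: "f \<in> smooth_ring \<Longrightarrow> smooth f"
proof (rule smooth_coinduct)
  fix f :: "'a \<Rightarrow> real" and x b :: 'a assume "f \<in> smooth_ring"
  then obtain f' where f': "\<And>x. (f has_derivative f' x) (at x)"
      "\<And>b. b \<in> Basis \<Longrightarrow> (\<lambda>x. f' x b) \<in> smooth_ring"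
    using smooth_ring_derivative by blast
  show "f differentiable at x" using f'(1) by (auto simp: differentiable_def)
  show "partial_deriv b f \<in> smooth_ring" if "b \<in> Basis"
    using f'(2)[OF that] partial_deriv_eq[OF f'(1), abs_def] by simp
qed

lemma smooth_const: "smooth (\<lambda>x. c)"
  and smooth_linear: "smooth (\<lambda>x. x \<bullet> v)"
  and smooth_flat: "smooth (\<lambda>x. flat n (x \<bullet> v + c))"
  by (auto intro: smooth_ring_smooth smooth_ring.intros)

lemma smooth_add: "smooth f \<Longrightarrow> smooth g \<Longrightarrow> smooth (\<lambda>x. f x + g x)"
  by (auto intro: smooth_ring_smooth smooth_ring.intros)

lemma smooth_mult: "smooth f \<Longrightarrow> smooth g \<Longrightarrow> smooth (\<lambda>x. f x * g x)"
  by (auto intro: smooth_ring_smooth smooth_ring.intros)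

lemma smooth_prod: "(\<And>i. i \<in> I \<Longrightarrow> smooth (f i)) \<Longrightarrow> smooth (\<lambda>x. \<Prod>i\<in>I. f i x)"
  by (induction I rule: infinite_finite_induct) (auto intro: smooth_const smooth_mult)

lemma partial_deriv_mult:
  assumes "smooth f" "smooth g"
  shows "partial_deriv b (\<lambda>x. f x * g x) x = f x * partial_deriv b g x + partial_deriv b f x * g x"
  using partial_deriv_eq[OF has_derivative_mult[OF assms[THEN smooth_has_derivative]]]
  by (simp add: partial_deriv_def)

lemma partial_deriv_linear: "partial_deriv b (\<lambda>x. x \<bullet> v) x = b \<bullet> v"
  by (rule partial_deriv_eq) (auto intro: derivative_eq_intros)

lemma DERIV_along_line:
  assumes "smooth f"
  shows "((\<lambda>t. f (x + t *\<^sub>R b)) has_real_derivative partial_deriv b f (x + t *\<^sub>R b)) (at t)"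
proof -
  have "((\<lambda>t. x + t *\<^sub>R b) has_derivative (\<lambda>h. h *\<^sub>R b)) (at t)"
    by (auto intro!: derivative_eq_intros)
  from has_derivative_compose[OF this smooth_has_derivative[OF assms]]
  have "((\<lambda>t. f (x + t *\<^sub>R b)) has_derivative
      (\<lambda>h. frechet_derivative f (at (x + t *\<^sub>R b)) (h *\<^sub>R b))) (at t)" .
  moreover have "linear (frechet_derivative f (at (x + t *\<^sub>R b)))"
    using smooth_has_derivative[OF assms] by (rule has_derivative_linear)
  ultimately show ?thesis
    by (simp add: has_field_derivative_def partial_deriv_def linear_cmul mult.commute[of _ "frechet_derivative f _ _"] cong: if_cong)
qed

subsection \<open>Compact support\<close>

lemma test_functions_smooth: "\<phi> \<in> test_functions \<Omega> \<Longrightarrow> smooth \<phi>"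
  by (simp add: test_functions_def)

text \<open>
  It suffices to bound the support by any compact set, which avoids computing closures.
\<close>
lemma test_functionsI:
  assumes "smooth \<psi>" "compact K" "K \<subseteq> \<Omega>" "\<And>x. x \<notin> K \<Longrightarrow> \<psi> x = 0"
  shows "\<psi> \<in> test_functions \<Omega>"
proof -
  have "closure {x. \<psi> x \<noteq> 0} \<subseteq> K"
    using assms(2,4) by (intro closure_minimal compact_imp_closed) auto
  moreover have "compact (closure {x. \<psi> x \<noteq> 0})"
    using calculation assms(2) by (meson bounded_subset closed_closure compact_eq_bounded_closed)
  ultimately show ?thesis using assms by (auto simp: test_functions_def)
qed

lemma test_functions_support:
  assumes "\<phi> \<in> test_functions \<Omega>"
  obtains K where "compact K" "K \<subseteq> \<Omega>" "\<And>x. x \<notin> K \<Longrightarrow> \<phi> x = 0"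
  using assms closure_subset[of "{x. \<phi> x \<noteq> 0}"]
  by (intro that[of "closure {x. \<phi> x \<noteq> 0}"]) (auto simp: test_functions_def)

lemma test_functions_mult:
  assumes "\<phi> \<in> test_functions \<Omega>" "smooth \<psi>"
  shows "(\<lambda>x. \<phi> x * \<psi> x) \<in> test_functions \<Omega>"
proof -
  obtain K where "compact K" "K \<subseteq> \<Omega>" "\<And>x. x \<notin> K \<Longrightarrow> \<phi> x = 0"
    using test_functions_support[OF assms(1)] by metis
  then show ?thesis
    by (intro test_functionsI[of _ K] smooth_mult test_functions_smooth[OF assms(1)] assms(2)) auto
qed

lemma test_functions_add:
  assumes "\<phi> \<in> test_functions \<Omega>" "\<psi> \<in> test_functions \<Omega>"
  shows "(\<lambda>x. \<phi> x + \<psi> x) \<in> test_functions \<Omega>"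
proof -
  obtain K where K: "compact K" "K \<subseteq> \<Omega>" "\<And>x. x \<notin> K \<Longrightarrow> \<phi> x = 0"
    using test_functions_support[OF assms(1)] by metis
  obtain L where L: "compact L" "L \<subseteq> \<Omega>" "\<And>x. x \<notin> L \<Longrightarrow> \<psi> x = 0"
    using test_functions_support[OF assms(2)] by metis
  show ?thesis
    by (rule test_functionsI[of _ "K \<union> L"])
       (use K L assms in \<open>auto intro: smooth_add test_functions_smooth compact_Un\<close>)
qed

lemma test_functions_partial_deriv:
  assumes "\<phi> \<in> test_functions \<Omega>" "b \<in> Basis"
  shows "partial_deriv b \<phi> \<in> test_functions \<Omega>"
proof -
  obtain K where K: "compact K" "K \<subseteq> \<Omega>" "\<And>x. x \<notin> K \<Longrightarrow> \<phi> x = 0"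
    using test_functions_support[OF assms(1)] by metis
  have "partial_deriv b \<phi> x = 0" if "x \<notin> K" for x
  proof -
    have "((\<lambda>x. 0) has_derivative (\<lambda>h. 0)) (at x)" by simp
    then have "(\<phi> has_derivative (\<lambda>h. 0)) (at x)"
      by (rule has_derivative_transform_within_open[of _ _ _ _ "- K"])
         (use K that in \<open>auto intro: compact_imp_closed\<close>)
    then show ?thesis by (simp add: partial_deriv_eq)
  qed
  then show ?thesis
    using K by (intro test_functionsI[of _ K] smooth_partial_deriv test_functions_smooth[OF assms(1)] assms(2)) auto
qed

lemma test_functions_bounded:
  assumes "\<phi> \<in> test_functions \<Omega>"
  obtains B where "0 \<le> B" "\<And>x. \<bar>\<phi> x\<bar> \<le> B"
proof -
  obtain K where K: "compact K" "K \<subseteq> \<Omega>" "\<And>x. x \<notin> K \<Longrightarrow> \<phi> x = 0"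
    using test_functions_support[OF assms] by metis
  have "bounded (\<phi> ` K)"
    by (intro compact_imp_bounded compact_continuous_image smooth_continuous_on
        test_functions_smooth[OF assms] K)
  then obtain B where "\<And>x. x \<in> K \<Longrightarrow> \<bar>\<phi> x\<bar> \<le> B" by (auto simp: bounded_iff)
  then have "\<bar>\<phi> x\<bar> \<le> max 0 B" for x using K(3)[of x] by (cases "x \<in> K") force+
  then show ?thesis by (intro that[of "max 0 B"]) auto
qed

text \<open>
  Integrals of difference quotients vanish by translation invariance. The quotients converge to the
  derivative, and they are bounded by its maximum on a fixed ball, by the mean value theorem.
\<close>

lemma integral_partial_deriv_lborel:
  assumes \<psi>: "\<psi> \<in> test_functions (UNIV :: 'a::euclidean_space set)" and b: "b \<in> Basis"
  shows "(\<integral>x. partial_deriv b \<psi> x \<partial>lborel) = 0"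
proof -
  obtain K where K: "compact K" "\<And>x. x \<notin> K \<Longrightarrow> \<psi> x = 0"
    using test_functions_support[OF \<psi>] by metis
  obtain R where R: "\<And>x. x \<in> K \<Longrightarrow> norm x \<le> R"
    using compact_imp_bounded[OF K(1)] by (auto simp: bounded_iff)
  obtain B where B: "0 \<le> B" "\<And>x. \<bar>partial_deriv b \<psi> x\<bar> \<le> B"
    using test_functions_bounded[OF test_functions_partial_deriv[OF \<psi> b]] by metis
  obtain B0 where B0: "0 \<le> B0" "\<And>x. \<bar>\<psi> x\<bar> \<le> B0"
    using test_functions_bounded[OF \<psi>] by metis
  have [measurable]: "\<psi> \<in> borel_measurable borel" "partial_deriv b \<psi> \<in> borel_measurable borel"
    using \<psi> b by (auto intro: smooth_borel_measurable smooth_partial_deriv test_functions_smooth)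
  have ball: "integrable lborel (indicator (cball 0 r) :: 'a \<Rightarrow> real)" for r
    by (rule integrable_real_indicator)
       (use emeasure_bounded_finite[OF bounded_cball[of "0::'a" r]] in auto)
  have int: "integrable lborel \<psi>"
  proof (rule Bochner_Integration.integrable_bound[OF integrable_mult_right[OF ball[of R], of B0]])
    show "AE x in lborel. norm (\<psi> x) \<le> norm (B0 * indicator (cball 0 R) x)"
      using B0 R K(2) by (intro AE_I2) (auto simp: indicator_def abs_mult)
  qed simp
  have shift: "integrable lborel (\<lambda>x. \<psi> (x + c))" "(\<integral>x. \<psi> (x + c) \<partial>lborel) = (\<integral>x. \<psi> x \<partial>lborel)" for c
  proof -
    have "integrable (distr lborel borel ((+) c)) \<psi>" using int by (simp add: lborel_distr_plus)
    then show "integrable lborel (\<lambda>x. \<psi> (x + c))"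
      by (subst (asm) integrable_distr_eq) (auto simp: add.commute)
    have "(\<integral>x. \<psi> x \<partial>distr lborel borel ((+) c)) = (\<integral>x. \<psi> (c + x) \<partial>lborel)"
      by (rule integral_distr) auto
    then show "(\<integral>x. \<psi> (x + c) \<partial>lborel) = (\<integral>x. \<psi> x \<partial>lborel)"
      by (simp add: lborel_distr_plus add.commute)
  qed
  define h where "h n = inverse (real (Suc n))" for n
  have h: "0 < h n" "h n \<le> 1" for n by (auto simp: h_def field_simps)
  define q where "q n x = (\<psi> (x + h n *\<^sub>R b) - \<psi> x) / h n" for n x
  have "(\<lambda>n. \<integral>x. q n x \<partial>lborel) \<longlonglongrightarrow> (\<integral>x. partial_deriv b \<psi> x \<partial>lborel)"
  proof (rule integral_dominated_convergence)
    show "integrable lborel (\<lambda>x::'a. B * indicator (cball 0 (R + 1)) x)"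
      by (intro integrable_mult_right ball)
    show "AE x in lborel. (\<lambda>n. q n x) \<longlonglongrightarrow> partial_deriv b \<psi> x"
    proof (rule AE_I2)
      fix x
      have "((\<lambda>t. (\<psi> (x + t *\<^sub>R b) - \<psi> x) / t) \<longlongrightarrow> partial_deriv b \<psi> x) (at 0)"
        using DERIV_along_line[OF test_functions_smooth[OF \<psi>], of x b 0]
        by (simp add: has_field_derivative_iff)
      moreover have "filterlim h (at 0) sequentially"
        using LIMSEQ_inverse_real_of_nat h(1) unfolding h_def[abs_def]
        by (intro filterlim_atI) (auto intro: always_eventually)
      ultimately show "(\<lambda>n. q n x) \<longlonglongrightarrow> partial_deriv b \<psi> x"
        unfolding q_def by (rule filterlim_compose)
    qed
    fix n
    show "AE x in lborel. norm (q n x) \<le> B * indicator (cball 0 (R + 1)) x"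
    proof (rule AE_I2)
      fix x
      show "norm (q n x) \<le> B * indicator (cball 0 (R + 1)) x"
      proof (cases "norm x \<le> R + 1")
        case True
        obtain z where "\<psi> (x + h n *\<^sub>R b) - \<psi> (x + 0 *\<^sub>R b)
            = (h n - 0) * partial_deriv b \<psi> (x + z *\<^sub>R b)"
          using MVT2[of 0 "h n" "\<lambda>t. \<psi> (x + t *\<^sub>R b)" "\<lambda>t. partial_deriv b \<psi> (x + t *\<^sub>R b)"]
            DERIV_along_line[OF test_functions_smooth[OF \<psi>]] h(1) by blast
        then have "q n x = partial_deriv b \<psi> (x + z *\<^sub>R b)"
          using h(1)[of n] by (simp add: q_def field_simps)
        then show ?thesis using B(2) True by simp
      next
        case False
        have "norm x \<le> norm (x + h n *\<^sub>R b) + norm (h n *\<^sub>R b)"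
          using norm_triangle_ineq4[of "x + h n *\<^sub>R b" "h n *\<^sub>R b"] by simp
        moreover have "norm (h n *\<^sub>R b) \<le> 1" using h[of n] b by simp
        ultimately have "\<not> norm (x + h n *\<^sub>R b) \<le> R" "\<not> norm x \<le> R" using False by linarith+
        then have "\<psi> (x + h n *\<^sub>R b) = 0" "\<psi> x = 0" using K(2) R by blast+
        then show ?thesis by (simp add: q_def False)
      qed
    qed
  qed (auto simp: q_def)
  moreover have "(\<integral>x. q n x \<partial>lborel) = 0" for n
    unfolding q_def using shift int by simp
  ultimately show ?thesis by (simp add: LIMSEQ_const_iff)
qed

lemma integral_lebesgue_on_eq_lborel:
  fixes f :: "'a::euclidean_space \<Rightarrow> real"
  assumes "f \<in> borel_measurable borel" "\<Omega> \<in> sets lebesgue" "\<And>x. x \<notin> \<Omega> \<Longrightarrow> f x = 0"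
  shows "(\<integral>x. f x \<partial>lebesgue_on \<Omega>) = (\<integral>x. f x \<partial>lborel)"
proof -
  have "(\<integral>x. f x \<partial>lebesgue_on \<Omega>) = (\<integral>x. indicator \<Omega> x *\<^sub>R f x \<partial>lebesgue)"
    using assms(2) by (intro integral_restrict_space) simp
  also have "(\<lambda>x. indicator \<Omega> x *\<^sub>R f x) = f"
    using assms(3) by (auto simp: indicator_def fun_eq_iff)
  also have "(\<integral>x. f x \<partial>lebesgue) = (\<integral>x. f x \<partial>lborel)"
    using assms(1) by (intro integral_completion) simp
  finally show ?thesis .
qed

lemma integral_partial_deriv:
  assumes "\<Omega> \<in> sets lebesgue" "\<psi> \<in> test_functions \<Omega>" "b \<in> Basis"
  shows "(\<integral>x. partial_deriv b \<psi> x \<partial>lebesgue_on \<Omega>) = 0"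
proof -
  have "partial_deriv b \<psi> x = 0" if "x \<notin> \<Omega>" for x
    by (rule test_functions_support[OF test_functions_partial_deriv[OF assms(2,3)]])
       (use that in auto)
  then have "(\<integral>x. partial_deriv b \<psi> x \<partial>lebesgue_on \<Omega>) = (\<integral>x. partial_deriv b \<psi> x \<partial>lborel)"
    using assms by (intro integral_lebesgue_on_eq_lborel smooth_borel_measurable
        smooth_partial_deriv test_functions_smooth) auto
  also have "\<dots> = 0"
    using assms by (intro integral_partial_deriv_lborel) (auto simp: test_functions_def)
  finally show ?thesis .
qed

lemma test_functions_L2:
  assumes "\<Omega> \<in> lmeasurable" "\<phi> \<in> test_functions \<Omega>" shows "\<phi> \<in> L2 \<Omega>"
proof -
  obtain B where B: "\<And>x. \<bar>\<phi> x\<bar> \<le> B" using test_functions_bounded[OF assms(2)] by metis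
  have "\<phi> \<in> borel_measurable (lebesgue_on \<Omega>)"
    using smooth_borel_measurable[OF test_functions_smooth[OF assms(2)]]
    by (intro measurable_restrict_space1 measurable_completion) simp
  moreover have "(norm (\<phi> x))\<^sup>2 \<le> B\<^sup>2" for x using power_mono[OF B[of x], of 2] by simp
  ultimately show ?thesis
    by (intro L2_bound[where k = "\<lambda>x. B\<^sup>2"] finite_measure.integrable_const
        finite_measure_lebesgue_on assms)
qed

lemma integration_by_parts:
  assumes \<Omega>: "\<Omega> \<in> lmeasurable" and "\<phi> \<in> test_functions \<Omega>" "smooth \<psi>" "b \<in> Basis"
  shows "(\<integral>x. \<phi> x * partial_deriv b \<psi> x \<partial>lebesgue_on \<Omega>)
    = - (\<integral>x. partial_deriv b \<phi> x * \<psi> x \<partial>lebesgue_on \<Omega>)"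
proof -
  note sm = test_functions_smooth[OF assms(2)]
  have int: "integrable (lebesgue_on \<Omega>) f" if "f \<in> test_functions \<Omega>" for f
    using that \<Omega> by (intro L2_integrable test_functions_L2)
  have "0 = (\<integral>x. partial_deriv b (\<lambda>x. \<phi> x * \<psi> x) x \<partial>lebesgue_on \<Omega>)"
    using assms by (intro integral_partial_deriv[symmetric] test_functions_mult) auto
  also have "\<dots> = (\<integral>x. \<phi> x * partial_deriv b \<psi> x + partial_deriv b \<phi> x * \<psi> x \<partial>lebesgue_on \<Omega>)"
    by (simp add: partial_deriv_mult sm assms)
  also have "\<dots> = (\<integral>x. \<phi> x * partial_deriv b \<psi> x \<partial>lebesgue_on \<Omega>)
      + (\<integral>x. partial_deriv b \<phi> x * \<psi> x \<partial>lebesgue_on \<Omega>)"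
    using assms by (intro Bochner_Integration.integral_add int test_functions_mult
        smooth_partial_deriv test_functions_partial_deriv)
  finally show ?thesis by simp
qed

section \<open>The fundamental lemma of the calculus of variations\<close>

text \<open>Positive exactly on the open box. As \<open>k\<close> grows, the bumps increase to its indicator function.\<close>

definition box_bump :: "'a::euclidean_space \<Rightarrow> 'a \<Rightarrow> real \<Rightarrow> 'a \<Rightarrow> real" where
  "box_bump a b k x = (\<Prod>i\<in>Basis. flat 0 (k * (x \<bullet> i - a \<bullet> i)) * flat 0 (k * (b \<bullet> i - x \<bullet> i)))"

lemma smooth_box_bump: "smooth (box_bump a b k)"
proof -
  have "flat 0 (k * (x \<bullet> i - a \<bullet> i)) = flat 0 (x \<bullet> (k *\<^sub>R i) + - (k * (a \<bullet> i)))"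
    "flat 0 (k * (b \<bullet> i - x \<bullet> i)) = flat 0 (x \<bullet> (- k *\<^sub>R i) + k * (b \<bullet> i))" for x i
    by (simp_all add: algebra_simps)
  then have "box_bump a b k = (\<lambda>x. \<Prod>i\<in>Basis. flat 0 (x \<bullet> (k *\<^sub>R i) + - (k * (a \<bullet> i))) *
      flat 0 (x \<bullet> (- k *\<^sub>R i) + k * (b \<bullet> i)))"
    by (simp add: box_bump_def[abs_def])
  then show ?thesis by (simp only:) (intro smooth_prod smooth_mult smooth_flat)
qed

lemma box_bump_bounds: "0 \<le> box_bump a b k x" "box_bump a b k x \<le> 1"
  unfolding box_bump_def
  by (auto intro!: prod_nonneg prod_le_1 mult_nonneg_nonneg mult_le_one flat_0_bounds)

lemma box_bump_eq_0:
  assumes "x \<notin> box a b" "0 < k" shows "box_bump a b k x = 0"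
proof -
  obtain i where "i \<in> Basis" "\<not> (a \<bullet> i < x \<bullet> i \<and> x \<bullet> i < b \<bullet> i)"
    using assms(1) by (auto simp: mem_box)
  moreover from this have "flat 0 (k * (x \<bullet> i - a \<bullet> i)) * flat 0 (k * (b \<bullet> i - x \<bullet> i)) = 0"
    using flat_pos_iff[of "k * (x \<bullet> i - a \<bullet> i)"] flat_pos_iff[of "k * (b \<bullet> i - x \<bullet> i)"] assms(2)
    by (auto simp: zero_less_mult_iff)
  ultimately show ?thesis unfolding box_bump_def by auto
qed

lemma box_bump_test_function:
  "cbox a b \<subseteq> \<Omega> \<Longrightarrow> 0 < k \<Longrightarrow> box_bump a b k \<in> test_functions \<Omega>"
  by (rule test_functionsI[of _ "cbox a b"])
     (use box_subset_cbox[of a b] in \<open>auto intro!: smooth_box_bump box_bump_eq_0\<close>)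

lemma flat_0_tendsto_1:
  assumes "0 < t" shows "(\<lambda>n. flat 0 (real (Suc n) * t)) \<longlonglongrightarrow> 1"
proof -
  have "(\<lambda>n. exp (- (inverse (real (Suc n)) * inverse t))) \<longlonglongrightarrow> exp (- (0 * inverse t))"
    by (intro tendsto_intros LIMSEQ_inverse_real_of_nat)
  moreover have "flat 0 (real (Suc n) * t) = exp (- (inverse (real (Suc n)) * inverse t))" for n
    using assms by (simp add: flat_def divide_inverse)
  ultimately show ?thesis by simp
qed

lemma box_bump_tendsto: "(\<lambda>n. box_bump a b (real (Suc n)) x) \<longlonglongrightarrow> indicator (box a b) x"
proof (cases "x \<in> box a b")
  case True
  have "(\<lambda>n. box_bump a b (real (Suc n)) x) \<longlonglongrightarrow> (\<Prod>i\<in>(Basis::'a set). 1 * 1)"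
    unfolding box_bump_def
    by (intro tendsto_prod tendsto_mult flat_0_tendsto_1) (use True in \<open>auto simp: mem_box\<close>)
  then show ?thesis using True by simp
next
  case False
  then show ?thesis by (simp add: box_bump_eq_0)
qed

locale bounded_open_set =
  fixes \<Omega> :: "'a::euclidean_space set"
  assumes open_\<Omega>: "open \<Omega>" and bounded_\<Omega>: "bounded \<Omega>"
begin

lemma \<Omega>_lmeasurable: "\<Omega> \<in> lmeasurable"
  using open_\<Omega> bounded_\<Omega> by (rule lmeasurable_open[rotated])

lemma \<Omega>_lebesgue: "\<Omega> \<in> sets lebesgue"
  using \<Omega>_lmeasurable by (rule fmeasurableD)

lemma test_L2 [intro]: "\<phi> \<in> test_functions \<Omega> \<Longrightarrow> \<phi> \<in> L2 \<Omega>"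
  using test_functions_L2[OF \<Omega>_lmeasurable] .

lemma AE_\<Omega>_iff: "(AE x in lebesgue_on \<Omega>. P x) \<longleftrightarrow> (AE x in lebesgue. x \<in> \<Omega> \<longrightarrow> P x)"
  using \<Omega>_lebesgue by (intro AE_restrict_space_iff) simp

text \<open>
  The boxes form an intersection-stable generator of the Borel sets, and the sets over whose
  intersection with a fixed box the integral vanishes form a Dynkin system. The fixed box keeps
  everything inside \<open>\<Omega>\<close>.
\<close>
lemma set_integral_borel_box_eq_0:
  assumes int: "integrable (lebesgue_on \<Omega>) h"
    and box: "\<And>c d. cbox c d \<subseteq> \<Omega> \<Longrightarrow> (LINT x:box c d|lebesgue_on \<Omega>. h x) = (0::real)"
    and ab: "cbox a b \<subseteq> \<Omega>" and A: "A \<in> sets borel"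
  shows "(LINT x:A \<inter> box a b|lebesgue_on \<Omega>. h x) = 0"
proof -
  let ?M = "lebesgue_on \<Omega>"
  let ?G = "range (\<lambda>(a, b). box a b :: 'a set)"
  have sub: "box a b \<subseteq> \<Omega>" using ab box_subset_cbox by blast
  have sets: "A \<inter> box a b \<in> sets ?M" if "A \<in> sets borel" for A
    using that sub \<Omega>_lebesgue by (auto simp: sets_restrict_space_iff)
  have sint: "set_integrable ?M (A \<inter> box a b) h" if "A \<in> sets borel" for A
    unfolding set_integrable_def using sets[OF that] int by (rule integrable_mult_indicator)
  have borel: "sigma_sets UNIV ?G = sets (borel :: 'a measure)"
    by (subst borel_eq_box) simp
  have "Int_stable ?G"
    by (auto simp: Int_stable_def box_Int_box)
  moreover have "?G \<subseteq> Pow UNIV" by simp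
  moreover have "A \<in> sigma_sets UNIV ?G" using A borel by simp
  ultimately show ?thesis
  proof (induction rule: sigma_sets_induct_disjoint)
    case (basic A)
    then obtain c d where "A = box c d" by auto
    then obtain e f where ef: "A \<inter> box a b = box e f" by (simp add: box_Int_box)
    show ?case
    proof (cases "box e f = {}")
      case True
      then show ?thesis by (simp add: ef set_lebesgue_integral_def)
    next
      case False
      have "box e f \<subseteq> box a b" using ef by blast
      then have "closure (box e f) \<subseteq> cbox a b"
        by (intro closure_minimal) (use box_subset_cbox in auto)
      then have "cbox e f \<subseteq> \<Omega>" using False ab by (simp add: closure_box)
      then show ?thesis using box ef by simp
    qed
  next
    case empty
    show ?case by (simp add: set_lebesgue_integral_def)
  next
    case (compl A)
    then have A: "A \<in> sets borel" using borel by simp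
    have "(LINT x:(A \<inter> box a b) \<union> ((UNIV - A) \<inter> box a b)|?M. h x)
        = (LINT x:A \<inter> box a b|?M. h x) + (LINT x:(UNIV - A) \<inter> box a b|?M. h x)"
      using A by (intro set_integral_Un sint) auto
    moreover have "(A \<inter> box a b) \<union> ((UNIV - A) \<inter> box a b) = box a b" by blast
    ultimately show ?case using compl box[OF ab] by simp
  next
    case (union A)
    then have A: "\<And>i. A i \<in> sets borel" using borel by auto
    have "(LINT x:(\<Union>i. A i \<inter> box a b)|?M. h x) = (\<Sum>i. LINT x:A i \<inter> box a b|?M. h x)"
    proof (rule lebesgue_integral_countable_add)
      show "(A i \<inter> box a b) \<inter> (A j \<inter> box a b) = {}" if "i \<noteq> j" for i j
        using union(1) that by (auto simp: disjoint_family_on_def)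
      show "set_integrable ?M (\<Union>i. A i \<inter> box a b) h"
        using sint[of "\<Union>i. A i"] A by simp
    qed (use sets A in auto)
    then show ?case using union by simp
  qed
qed

text \<open>
  Testing with bumps that increase to the indicator of a box shows that the integral over every box
  with closure in \<open>\<Omega>\<close> vanishes. A function is determined almost everywhere by its integrals over
  measurable sets, and countably many such boxes cover \<open>\<Omega>\<close>.
\<close>
lemma fundamental_lemma:
  assumes h: "h \<in> L2 \<Omega>" and orth: "\<And>\<phi>. \<phi> \<in> test_functions \<Omega> \<Longrightarrow> L2_inner \<Omega> h \<phi> = (0::real)"
  shows "AE x in lebesgue_on \<Omega>. h x = 0"
proof -
  let ?M = "lebesgue_on \<Omega>"
  have int: "integrable ?M h" using L2_integrable[OF \<Omega>_lmeasurable h] .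
  note [measurable] = L2_measurable[OF h]
  have box: "(LINT x:box a b|?M. h x) = 0" if ab: "cbox a b \<subseteq> \<Omega>" for a b
  proof -
    have meas: "box_bump a b k \<in> borel_measurable ?M" for k
      using smooth_borel_measurable[OF smooth_box_bump]
      by (intro measurable_restrict_space1 measurable_completion) simp
    have "(\<lambda>n. \<integral>x. h x * box_bump a b (real (Suc n)) x \<partial>?M) \<longlonglongrightarrow> (\<integral>x. h x * indicator (box a b) x \<partial>?M)"
    proof (rule integral_dominated_convergence[where w = "\<lambda>x. \<bar>h x\<bar>"])
      show "AE x in ?M. (\<lambda>n. h x * box_bump a b (real (Suc n)) x) \<longlonglongrightarrow> h x * indicator (box a b) x"
        by (intro AE_I2 tendsto_mult box_bump_tendsto tendsto_const)
      show "AE x in ?M. norm (h x * box_bump a b (real (Suc n)) x) \<le> \<bar>h x\<bar>" for n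
        using box_bump_bounds(2)
        by (intro AE_I2)
           (auto simp: abs_mult abs_of_nonneg[OF box_bump_bounds(1)] intro!: mult_left_le)
      show "integrable ?M (\<lambda>x. \<bar>h x\<bar>)" using int by simp
      show "(\<lambda>x. h x * box_bump a b (real (Suc n)) x) \<in> borel_measurable ?M" for n
        using meas by measurable
      have "(\<lambda>x. indicator (box a b) x :: real) \<in> borel_measurable ?M"
        by (intro measurable_restrict_space1 measurable_completion) simp
      then show "(\<lambda>x. h x * indicator (box a b) x) \<in> borel_measurable ?M" by measurable
    qed
    moreover have "(\<integral>x. h x * box_bump a b (real (Suc n)) x \<partial>?M) = 0" for n
      using orth[OF box_bump_test_function[OF ab, of "real (Suc n)"]] by (simp add: L2_inner_def)
    ultimately have "(\<integral>x. h x * indicator (box a b) x \<partial>?M) = 0"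
      by (simp add: LIMSEQ_const_iff)
    then show ?thesis by (simp add: set_lebesgue_integral_def mult.commute)
  qed
  have AE_box: "AE x in ?M. x \<in> box a b \<longrightarrow> h x = 0" if ab: "cbox a b \<subseteq> \<Omega>" for a b
  proof -
    have sub: "box a b \<subseteq> \<Omega>" using ab box_subset_cbox by blast
    then have Q: "box a b \<in> sets ?M" using \<Omega>_lebesgue by (auto simp: sets_restrict_space_iff)
    have "AE x in ?M. indicator (box a b) x * h x = 0"
    proof (rule density_unique_real)
      show "integrable ?M (\<lambda>x. indicator (box a b) x * h x)"
        using integrable_mult_indicator[OF Q int] by simp
      fix A assume "A \<in> sets ?M"
      then have "A \<in> sets lebesgue" "A \<subseteq> \<Omega>" using \<Omega>_lebesgue by (auto simp: sets_restrict_space_iff)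
      \<comment> \<open>A Lebesgue set is a Borel set up to a null set.\<close>
      then obtain S N N' where A: "A = S \<union> N" "N \<subseteq> N'" "N' \<in> null_sets lborel" "S \<in> sets lborel"
        by (auto elim: sets_completionE)
      have "N' \<in> null_sets lebesgue" using A(3) by (rule null_sets_completionI)
      then have "AE x in ?M. x \<notin> N'"
        unfolding AE_\<Omega>_iff by (rule AE_mp[OF AE_not_in]) simp
      then have eq: "AE x in ?M. x \<in> A \<inter> box a b \<longleftrightarrow> x \<in> S \<inter> box a b"
        by eventually_elim (use A in auto)
      have "(LINT x:A|?M. indicator (box a b) x * h x) = (LINT x:A \<inter> box a b|?M. h x)"
        unfolding set_lebesgue_integral_def
        by (intro Bochner_Integration.integral_cong) (auto simp: indicator_def)
      also have "\<dots> = (LINT x:S \<inter> box a b|?M. h x)"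
      proof (rule set_integral_cong_set)
        have *: "B \<inter> box a b \<in> sets ?M" if "B \<in> sets lebesgue" for B
          using that sub \<Omega>_lebesgue by (auto simp: sets_restrict_space_iff)
        show "set_borel_measurable ?M (A \<inter> box a b) h" "set_borel_measurable ?M (S \<inter> box a b) h"
          unfolding set_borel_measurable_def
          using *[of A] *[of S] \<open>A \<in> sets lebesgue\<close> A(4)
          by (auto intro!: borel_measurable_scaleR borel_measurable_indicator L2_measurable[OF h] sets_completionI_sets)
      qed (use eq in auto)
      also have "\<dots> = 0"
        using A(4) by (intro set_integral_borel_box_eq_0[OF int box ab]) auto
      finally show "(LINT x:A|?M. indicator (box a b) x * h x) = (LINT x:A|?M. 0)"
        by (simp add: set_lebesgue_integral_def)
    qed simp
    then show ?thesis by eventually_elim (auto simp: indicator_def)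
  qed
  obtain \<D> where \<D>: "countable \<D>" "\<D> \<subseteq> Pow \<Omega>" "\<And>X. X \<in> \<D> \<Longrightarrow> \<exists>a b. X = cbox a b" "\<Union>\<D> = \<Omega>"
    using open_countable_Union_open_cbox[OF open_\<Omega>] by metis
  have "AE x in ?M. x \<in> X \<longrightarrow> h x = 0" if member: "X \<in> \<D>" for X
  proof -
    obtain a b where X: "X = cbox a b" "cbox a b \<subseteq> \<Omega>"
      using \<D>(2) \<D>(3)[OF member] member by blast
    have "cbox a b - box a b \<in> null_sets lebesgue"
      using negligible_frontier_interval by (simp add: negligible_iff_null_sets)
    then have "AE x in ?M. x \<notin> cbox a b - box a b"
      unfolding AE_\<Omega>_iff by (rule AE_mp[OF AE_not_in]) simp
    with AE_box[OF X(2)] show ?thesis by eventually_elim (use X in auto)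
  qed
  then have "AE x in ?M. \<forall>X\<in>\<D>. x \<in> X \<longrightarrow> h x = 0"
    unfolding AE_ball_countable[OF \<D>(1)] by blast
  moreover have "AE x in ?M. x \<in> \<Omega>" by (rule AE_I2) simp
  ultimately show ?thesis by eventually_elim (use \<D>(4) in auto)
qed

end

section \<open>Weak gradients and the space with zero boundary values\<close>

definition grad :: "('a::euclidean_space \<Rightarrow> real) \<Rightarrow> 'a \<Rightarrow> 'a" where
  "grad \<phi> x = (\<Sum>b\<in>Basis. partial_deriv b \<phi> x *\<^sub>R b)"

lemma grad_inner: "b \<in> Basis \<Longrightarrow> grad \<phi> x \<bullet> b = partial_deriv b \<phi> x"
  by (simp add: grad_def)

lemma L2_sum: "finite I \<Longrightarrow> (\<And>i. i \<in> I \<Longrightarrow> f i \<in> L2 \<Omega>) \<Longrightarrow> (\<lambda>x. \<Sum>i\<in>I. f i x) \<in> L2 \<Omega>"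
proof (induction I rule: finite_induct)
  case empty
  show ?case by (simp add: L2_def)
qed (auto intro: L2_add)

lemma L2_norm_mono:
  assumes "f \<in> L2 \<Omega>" "g \<in> L2 \<Omega>" "0 \<le> c"
    and le: "AE x in lebesgue_on \<Omega>. norm (f x) \<le> c * norm (g x)"
  shows "L2_norm \<Omega> f \<le> c * L2_norm \<Omega> g"
proof (rule power2_le_imp_le)
  have "(\<integral>x. (norm (f x))\<^sup>2 \<partial>lebesgue_on \<Omega>) \<le> (\<integral>x. c\<^sup>2 * (norm (g x))\<^sup>2 \<partial>lebesgue_on \<Omega>)"
  proof (rule integral_mono_AE)
    show "AE x in lebesgue_on \<Omega>. (norm (f x))\<^sup>2 \<le> c\<^sup>2 * (norm (g x))\<^sup>2"
      using le
    proof eventually_elim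
      case (elim x)
      from power_mono[OF this, of 2] show ?case by (simp add: power_mult_distrib)
    qed
  qed (use assms in \<open>auto intro: L2_square_integrable\<close>)
  then show "(L2_norm \<Omega> f)\<^sup>2 \<le> (c * L2_norm \<Omega> g)\<^sup>2"
    by (simp add: L2_norm_square_integral power_mult_distrib)
qed (use assms in simp)

lemma is_weak_grad_L2: "is_weak_grad \<Omega> u G \<Longrightarrow> G \<in> L2 \<Omega>"
  by (simp add: is_weak_grad_def)

lemma H1_L2: "u \<in> H1 \<Omega> \<Longrightarrow> u \<in> L2 \<Omega>"
  by (simp add: H1_def)

lemma H10_H1: "u \<in> H10 \<Omega> \<Longrightarrow> u \<in> H1 \<Omega>"
  by (simp add: H10_def)

lemma H10_L2: "u \<in> H10 \<Omega> \<Longrightarrow> u \<in> L2 \<Omega>"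
  by (simp add: H10_def H1_def)

lemma is_weak_gradD: "is_weak_grad \<Omega> u G \<Longrightarrow> is_weak_grad \<Omega> u (weak_grad \<Omega> u)"
  unfolding weak_grad_def by (rule someI[of "is_weak_grad \<Omega> u"])

lemma is_weak_grad_weak_grad: "u \<in> H1 \<Omega> \<Longrightarrow> is_weak_grad \<Omega> u (weak_grad \<Omega> u)"
  unfolding H1_def by (auto intro: is_weak_gradD)

lemma weak_grad_L2: "u \<in> H1 \<Omega> \<Longrightarrow> weak_grad \<Omega> u \<in> L2 \<Omega>"
  by (rule is_weak_grad_L2[OF is_weak_grad_weak_grad])

lemma H1I: "u \<in> L2 \<Omega> \<Longrightarrow> is_weak_grad \<Omega> u G \<Longrightarrow> u \<in> H1 \<Omega>"
  by (auto simp: H1_def)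

lemma H1_norm_nonneg: "0 \<le> H1_norm \<Omega> u"
  by (simp add: H1_norm_def)

lemma L2_norm_le_H1_norm: "L2_norm \<Omega> u \<le> H1_norm \<Omega> u"
  by (simp add: H1_norm_def real_le_rsqrt)

lemma weak_grad_norm_le_H1_norm: "L2_norm \<Omega> (weak_grad \<Omega> u) \<le> H1_norm \<Omega> u"
  by (simp add: H1_norm_def real_le_rsqrt)

context bounded_open_set
begin

lemma is_weak_grad_add:
  assumes "u \<in> L2 \<Omega>" "v \<in> L2 \<Omega>" "is_weak_grad \<Omega> u G" "is_weak_grad \<Omega> v H"
  shows "is_weak_grad \<Omega> (\<lambda>x. u x + v x) (\<lambda>x. G x + H x)"
  using assms
  by (auto simp: is_weak_grad_def inner_add_left L2_inner_add_left test_L2 L2_inner_const_right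
      test_functions_partial_deriv)

lemma is_weak_grad_mult:
  assumes "is_weak_grad \<Omega> u G"
  shows "is_weak_grad \<Omega> (\<lambda>x. c * u x) (\<lambda>x. c *\<^sub>R G x)"
  using assms by (auto simp: is_weak_grad_def L2_inner_mult_left)

lemma is_weak_grad_diff:
  assumes "u \<in> L2 \<Omega>" "v \<in> L2 \<Omega>" "is_weak_grad \<Omega> u G" "is_weak_grad \<Omega> v H"
  shows "is_weak_grad \<Omega> (\<lambda>x. u x - v x) (\<lambda>x. G x - H x)"
  using is_weak_grad_add[OF assms(1) L2_mult[OF assms(2), of "-1"] assms(3)
      is_weak_grad_mult[OF assms(4), of "-1"]] by simp

text \<open>
  The difference of two weak gradients is orthogonal, in each component, to all test functions.
\<close>
lemma is_weak_grad_unique: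
  assumes "is_weak_grad \<Omega> u G" "is_weak_grad \<Omega> u H"
  shows "AE_eq \<Omega> G H"
proof -
  have L2: "G \<in> L2 \<Omega>" "H \<in> L2 \<Omega>" using assms by (auto intro: is_weak_grad_L2)
  have "AE x in lebesgue_on \<Omega>. (G x - H x) \<bullet> b = 0" if "b \<in> Basis" for b
  proof (rule fundamental_lemma)
    show "(\<lambda>x. (G x - H x) \<bullet> b) \<in> L2 \<Omega>" by (intro L2_inner_const_right L2_diff L2)
    fix \<phi> assume \<phi>: "\<phi> \<in> test_functions \<Omega>"
    then have "L2_inner \<Omega> (\<lambda>x. G x \<bullet> b) \<phi> = L2_inner \<Omega> (\<lambda>x. H x \<bullet> b) \<phi>"
      using assms that unfolding is_weak_grad_def by (metis neg_equal_iff_equal)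
    then show "L2_inner \<Omega> (\<lambda>x. (G x - H x) \<bullet> b) \<phi> = 0"
      using L2 \<phi> by (simp add: inner_diff_left L2_inner_diff_left L2_inner_const_right test_L2)
  qed
  then have "AE x in lebesgue_on \<Omega>. \<forall>b\<in>Basis. (G x - H x) \<bullet> b = 0"
    by (simp add: AE_finite_all)
  then show ?thesis
    unfolding AE_eq_def by eventually_elim (auto intro: euclidean_eqI simp: inner_diff_left)
qed

lemma weak_grad_eq: "is_weak_grad \<Omega> u G \<Longrightarrow> AE_eq \<Omega> (weak_grad \<Omega> u) G"
  by (rule is_weak_grad_unique[OF is_weak_gradD])

lemma weak_grad_inner_eq:
  assumes "is_weak_grad \<Omega> u G" "\<sigma> \<in> L2 \<Omega>"
  shows "L2_inner \<Omega> \<sigma> (weak_grad \<Omega> u) = L2_inner \<Omega> \<sigma> G"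
proof (rule L2_inner_cong)
  show "weak_grad \<Omega> u \<in> L2 \<Omega>"
    using assms(1) by (rule is_weak_grad_L2[OF is_weak_gradD])
qed (use assms in \<open>auto intro: is_weak_grad_L2 weak_grad_eq simp: AE_eq_def[of _ \<sigma>]\<close>)

lemma weak_grad_norm_eq:
  assumes "is_weak_grad \<Omega> u G"
  shows "L2_norm \<Omega> (weak_grad \<Omega> u) = L2_norm \<Omega> G"
proof (rule L2_norm_cong)
  show "weak_grad \<Omega> u \<in> L2 \<Omega>"
    using assms(1) by (rule is_weak_grad_L2[OF is_weak_gradD])
qed (use assms in \<open>auto intro: is_weak_grad_L2 weak_grad_eq\<close>)

lemma H1_norm_eq:
  "is_weak_grad \<Omega> u G \<Longrightarrow> H1_norm \<Omega> u = sqrt ((L2_norm \<Omega> u)\<^sup>2 + (L2_norm \<Omega> G)\<^sup>2)"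
  by (simp add: H1_norm_def weak_grad_norm_eq)

lemma is_weak_grad_weak_grad_diff:
  assumes "u \<in> H1 \<Omega>" "v \<in> H1 \<Omega>"
  shows "is_weak_grad \<Omega> (\<lambda>x. u x - v x) (\<lambda>x. weak_grad \<Omega> u x - weak_grad \<Omega> v x)"
  using assms by (intro is_weak_grad_diff H1_L2 is_weak_grad_weak_grad)

lemma is_weak_grad_weak_grad_add:
  assumes "u \<in> H1 \<Omega>" "v \<in> H1 \<Omega>"
  shows "is_weak_grad \<Omega> (\<lambda>x. u x + v x) (\<lambda>x. weak_grad \<Omega> u x + weak_grad \<Omega> v x)"
  using assms by (intro is_weak_grad_add H1_L2 is_weak_grad_weak_grad)

lemma H1_add: "u \<in> H1 \<Omega> \<Longrightarrow> v \<in> H1 \<Omega> \<Longrightarrow> (\<lambda>x. u x + v x) \<in> H1 \<Omega>"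
  by (rule H1I[OF L2_add is_weak_grad_weak_grad_add]) (auto intro: H1_L2)

lemma H1_mult: "u \<in> H1 \<Omega> \<Longrightarrow> (\<lambda>x. c * u x) \<in> H1 \<Omega>"
  by (rule H1I[OF L2_mult is_weak_grad_mult[OF is_weak_grad_weak_grad]]) (auto intro: H1_L2)

lemma H1_diff: "u \<in> H1 \<Omega> \<Longrightarrow> v \<in> H1 \<Omega> \<Longrightarrow> (\<lambda>x. u x - v x) \<in> H1 \<Omega>"
  using H1_add[of u "\<lambda>x. -1 * v x"] H1_mult[of v "-1"] by simp

lemma H1_norm_triangle:
  assumes "u \<in> H1 \<Omega>" "v \<in> H1 \<Omega>"
  shows "H1_norm \<Omega> (\<lambda>x. u x + v x) \<le> H1_norm \<Omega> u + H1_norm \<Omega> v"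
proof -
  have "H1_norm \<Omega> (\<lambda>x. u x + v x) = sqrt ((L2_norm \<Omega> (\<lambda>x. u x + v x))\<^sup>2
      + (L2_norm \<Omega> (\<lambda>x. weak_grad \<Omega> u x + weak_grad \<Omega> v x))\<^sup>2)"
    by (rule H1_norm_eq[OF is_weak_grad_weak_grad_add[OF assms]])
  also have "\<dots> \<le> sqrt ((L2_norm \<Omega> u + L2_norm \<Omega> v)\<^sup>2
      + (L2_norm \<Omega> (weak_grad \<Omega> u) + L2_norm \<Omega> (weak_grad \<Omega> v))\<^sup>2)"
    by (intro real_sqrt_le_mono add_mono power_mono L2_norm_triangle H1_L2 weak_grad_L2 assms
        L2_norm_nonneg)
  also have "\<dots> \<le> H1_norm \<Omega> u + H1_norm \<Omega> v"
    unfolding H1_norm_def by (rule real_sqrt_sum_squares_triangle_ineq)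
  finally show ?thesis .
qed

lemma H1_norm_mult:
  assumes "u \<in> H1 \<Omega>" shows "H1_norm \<Omega> (\<lambda>x. c * u x) = \<bar>c\<bar> * H1_norm \<Omega> u"
proof -
  have "H1_norm \<Omega> (\<lambda>x. c * u x) = sqrt ((\<bar>c\<bar> * L2_norm \<Omega> u)\<^sup>2 + (\<bar>c\<bar> * L2_norm \<Omega> (weak_grad \<Omega> u))\<^sup>2)"
    using H1_norm_eq[OF is_weak_grad_mult[OF is_weak_grad_weak_grad[OF assms], of c]]
      L2_norm_scaleR[of \<Omega> c u] by (simp add: L2_norm_scaleR)
  also have "\<dots> = sqrt (\<bar>c\<bar>\<^sup>2 * ((L2_norm \<Omega> u)\<^sup>2 + (L2_norm \<Omega> (weak_grad \<Omega> u))\<^sup>2))"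
    by (simp only: power_mult_distrib distrib_left)
  also have "\<dots> = \<bar>c\<bar> * H1_norm \<Omega> u"
    by (simp add: real_sqrt_mult H1_norm_def)
  finally show ?thesis .
qed

lemma grad_L2: "\<phi> \<in> test_functions \<Omega> \<Longrightarrow> grad \<phi> \<in> L2 \<Omega>"
  unfolding grad_def[abs_def]
proof (rule L2_sum)
  fix b :: 'a assume "\<phi> \<in> test_functions \<Omega>" "b \<in> Basis"
  then have "partial_deriv b \<phi> \<in> L2 \<Omega>" by (intro test_L2 test_functions_partial_deriv)
  moreover from this have "integrable (lebesgue_on \<Omega>) (\<lambda>x. (norm (partial_deriv b \<phi> x *\<^sub>R b))\<^sup>2)"
    using \<open>b \<in> Basis\<close> L2_square_integrable by fastforce
  ultimately show "(\<lambda>x. partial_deriv b \<phi> x *\<^sub>R b) \<in> L2 \<Omega>"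
    using L2_measurable by (auto simp: L2_def)
qed simp

lemma is_weak_grad_grad:
  assumes "\<phi> \<in> test_functions \<Omega>"
  shows "is_weak_grad \<Omega> \<phi> (grad \<phi>)"
  unfolding is_weak_grad_def
  using grad_L2[OF assms] integration_by_parts[OF \<Omega>_lmeasurable assms test_functions_smooth]
  by (auto simp: L2_inner_def grad_inner)

lemma test_functions_H1: "\<phi> \<in> test_functions \<Omega> \<Longrightarrow> \<phi> \<in> H1 \<Omega>"
  by (rule H1I[OF test_L2 is_weak_grad_grad])

lemma H10I:
  assumes "u \<in> H1 \<Omega>" "\<And>n::nat. \<phi> n \<in> test_functions \<Omega>" "\<And>n. H1_norm \<Omega> (\<lambda>x. u x - \<phi> n x) \<le> e n"
    and "e \<longlonglongrightarrow> 0"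
  shows "u \<in> H10 \<Omega>"
proof -
  have "(\<lambda>n. H1_norm \<Omega> (\<lambda>x. u x - \<phi> n x)) \<longlonglongrightarrow> 0"
    by (rule tendsto_sandwich[OF _ _ tendsto_const assms(4)])
       (auto simp: assms(3) H1_norm_nonneg)
  then show ?thesis using assms by (auto simp: H10_def)
qed

lemma H10_approx:
  assumes "u \<in> H10 \<Omega>"
  obtains \<phi> where "\<And>n::nat. \<phi> n \<in> test_functions \<Omega>" "(\<lambda>n. H1_norm \<Omega> (\<lambda>x. u x - \<phi> n x)) \<longlonglongrightarrow> 0"
  using assms by (auto simp: H10_def)

lemma test_functions_H10:
  assumes "\<phi> \<in> test_functions \<Omega>" shows "\<phi> \<in> H10 \<Omega>"
proof (rule H10I[where \<phi> = "\<lambda>n. \<phi>" and e = "\<lambda>n. 0"])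
  show "H1_norm \<Omega> (\<lambda>x. \<phi> x - \<phi> x) \<le> 0" for n :: nat
    using H1_norm_mult[OF test_functions_H1[OF assms], of 0] by simp
qed (use assms in \<open>auto intro: test_functions_H1\<close>)

lemma H10_add [intro]:
  assumes "u \<in> H10 \<Omega>" "v \<in> H10 \<Omega>" shows "(\<lambda>x. u x + v x) \<in> H10 \<Omega>"
proof -
  obtain \<phi> where \<phi>: "\<And>n::nat. \<phi> n \<in> test_functions \<Omega>" "(\<lambda>n. H1_norm \<Omega> (\<lambda>x. u x - \<phi> n x)) \<longlonglongrightarrow> 0"
    using H10_approx[OF assms(1)] by metis
  obtain \<psi> where \<psi>: "\<And>n::nat. \<psi> n \<in> test_functions \<Omega>" "(\<lambda>n. H1_norm \<Omega> (\<lambda>x. v x - \<psi> n x)) \<longlonglongrightarrow> 0"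
    using H10_approx[OF assms(2)] by metis
  show ?thesis
  proof (rule H10I)
    show "(\<lambda>x. u x + v x) \<in> H1 \<Omega>" using assms by (intro H1_add H10_H1)
    show "(\<lambda>x. \<phi> n x + \<psi> n x) \<in> test_functions \<Omega>" for n using \<phi> \<psi> by (intro test_functions_add)
    show "H1_norm \<Omega> (\<lambda>x. (u x + v x) - (\<phi> n x + \<psi> n x))
        \<le> H1_norm \<Omega> (\<lambda>x. u x - \<phi> n x) + H1_norm \<Omega> (\<lambda>x. v x - \<psi> n x)" for n
      using H1_norm_triangle[of "\<lambda>x. u x - \<phi> n x" "\<lambda>x. v x - \<psi> n x"] assms \<phi>(1) \<psi>(1)
      by (simp add: H1_diff H10_H1 test_functions_H1 algebra_simps)
    show "(\<lambda>n. H1_norm \<Omega> (\<lambda>x. u x - \<phi> n x) + H1_norm \<Omega> (\<lambda>x. v x - \<psi> n x)) \<longlonglongrightarrow> 0"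
      using tendsto_add[OF \<phi>(2) \<psi>(2)] by simp
  qed
qed

lemma H10_mult [intro]:
  assumes "u \<in> H10 \<Omega>" shows "(\<lambda>x. c * u x) \<in> H10 \<Omega>"
proof -
  obtain \<phi> where \<phi>: "\<And>n::nat. \<phi> n \<in> test_functions \<Omega>" "(\<lambda>n. H1_norm \<Omega> (\<lambda>x. u x - \<phi> n x)) \<longlonglongrightarrow> 0"
    using H10_approx[OF assms(1)] by metis
  show ?thesis
  proof (rule H10I)
    show "(\<lambda>x. c * u x) \<in> H1 \<Omega>" using assms by (intro H1_mult H10_H1)
    show "(\<lambda>x. c * \<phi> n x) \<in> test_functions \<Omega>" for n
      using test_functions_mult[OF \<phi>(1)[of n] smooth_const[of c]] by (simp add: mult.commute)
    show "H1_norm \<Omega> (\<lambda>x. c * u x - c * \<phi> n x) \<le> \<bar>c\<bar> * H1_norm \<Omega> (\<lambda>x. u x - \<phi> n x)" for n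
      using H1_norm_mult[of "\<lambda>x. u x - \<phi> n x" c] assms \<phi>(1)
      by (simp add: H1_diff H10_H1 test_functions_H1 right_diff_distrib)
    show "(\<lambda>n. \<bar>c\<bar> * H1_norm \<Omega> (\<lambda>x. u x - \<phi> n x)) \<longlonglongrightarrow> 0"
      using tendsto_mult_left[OF \<phi>(2)] by simp
  qed
qed

lemma H10_diff [intro]: "u \<in> H10 \<Omega> \<Longrightarrow> v \<in> H10 \<Omega> \<Longrightarrow> (\<lambda>x. u x - v x) \<in> H10 \<Omega>"
  using H10_add[of u "\<lambda>x. -1 * v x"] H10_mult[of v "-1"] by simp

text \<open>
  The defining identity of weak gradients is stable under convergence of both the functions and
  their gradients. Approximating the \<open>n\<close>-th function by a test function up to \<open>1 / (n + 1)\<close> yields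
  test functions that converge to the limit.
\<close>

lemma H10_closed:
  assumes u: "\<And>n. u n \<in> H10 \<Omega>" and v: "v \<in> L2 \<Omega>" and G: "G \<in> L2 \<Omega>"
    and lim_u: "(\<lambda>n::nat. L2_norm \<Omega> (\<lambda>x. u n x - v x)) \<longlonglongrightarrow> 0"
    and lim_G: "(\<lambda>n. L2_norm \<Omega> (\<lambda>x. weak_grad \<Omega> (u n) x - G x)) \<longlonglongrightarrow> 0"
  shows "v \<in> H10 \<Omega>" "is_weak_grad \<Omega> v G"
proof -
  have L2: "u n \<in> L2 \<Omega>" "weak_grad \<Omega> (u n) \<in> L2 \<Omega>" for n
    using u by (auto intro: H10_L2 weak_grad_L2 H10_H1)
  show wG: "is_weak_grad \<Omega> v G"
    unfolding is_weak_grad_def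
  proof (intro conjI ballI G)
    fix \<phi> b assume \<phi>: "\<phi> \<in> test_functions \<Omega>" and b: "b \<in> (Basis :: 'a set)"
    have "(\<lambda>n. L2_norm \<Omega> (\<lambda>x. weak_grad \<Omega> (u n) x \<bullet> b - G x \<bullet> b)) \<longlonglongrightarrow> 0"
    proof (rule tendsto_sandwich[OF _ _ tendsto_const lim_G])
      have "L2_norm \<Omega> (\<lambda>x. weak_grad \<Omega> (u n) x \<bullet> b - G x \<bullet> b)
          \<le> 1 * L2_norm \<Omega> (\<lambda>x. weak_grad \<Omega> (u n) x - G x)" for n
        using b Basis_le_norm L2 G
        by (intro L2_norm_mono L2_diff L2_inner_const_right) (auto simp: inner_diff_left[symmetric])
      then show "\<forall>\<^sub>F n in sequentially. L2_norm \<Omega> (\<lambda>x. weak_grad \<Omega> (u n) x \<bullet> b - G x \<bullet> b)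
          \<le> L2_norm \<Omega> (\<lambda>x. weak_grad \<Omega> (u n) x - G x)" by simp
    qed simp
    then have "(\<lambda>n. - L2_inner \<Omega> (\<lambda>x. weak_grad \<Omega> (u n) x \<bullet> b) \<phi>)
        \<longlonglongrightarrow> - L2_inner \<Omega> (\<lambda>x. G x \<bullet> b) \<phi>"
      using L2 G \<phi> by (intro tendsto_minus L2_inner_tendsto) auto
    moreover have "(\<lambda>n. L2_inner \<Omega> (u n) (partial_deriv b \<phi>)) \<longlonglongrightarrow> L2_inner \<Omega> v (partial_deriv b \<phi>)"
      by (rule L2_inner_tendsto[OF L2(1) v lim_u test_L2[OF test_functions_partial_deriv[OF \<phi> b]]])
    moreover have "L2_inner \<Omega> (u n) (partial_deriv b \<phi>)
        = - L2_inner \<Omega> (\<lambda>x. weak_grad \<Omega> (u n) x \<bullet> b) \<phi>" for n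
      using is_weak_grad_weak_grad[OF H10_H1[OF u]] \<phi> b unfolding is_weak_grad_def by blast
    ultimately show "L2_inner \<Omega> v (partial_deriv b \<phi>) = - L2_inner \<Omega> (\<lambda>x. G x \<bullet> b) \<phi>"
      by (simp add: LIMSEQ_unique)
  qed
  have vH: "v \<in> H1 \<Omega>" using v wG by (rule H1I)
  have "\<exists>\<phi>. \<phi> \<in> test_functions \<Omega> \<and> H1_norm \<Omega> (\<lambda>x. u n x - \<phi> x) \<le> inverse (real (Suc n))" for n
  proof -
    obtain \<phi> where \<phi>: "\<And>k::nat. \<phi> k \<in> test_functions \<Omega>" "(\<lambda>k. H1_norm \<Omega> (\<lambda>x. u n x - \<phi> k x)) \<longlonglongrightarrow> 0"
      using H10_approx[OF u] by metis
    have "\<forall>\<^sub>F k in sequentially. H1_norm \<Omega> (\<lambda>x. u n x - \<phi> k x) < inverse (real (Suc n))"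
      by (rule order_tendstoD(2)[OF \<phi>(2)]) simp
    then obtain k where "H1_norm \<Omega> (\<lambda>x. u n x - \<phi> k x) < inverse (real (Suc n))"
      by (auto simp: eventually_sequentially)
    then show ?thesis using \<phi>(1) by (intro exI[of _ "\<phi> k"]) simp
  qed
  then obtain \<phi> where \<phi>: "\<And>n. \<phi> n \<in> test_functions \<Omega>"
      "\<And>n. H1_norm \<Omega> (\<lambda>x. u n x - \<phi> n x) \<le> inverse (real (Suc n))" by metis
  define e where "e n = sqrt ((L2_norm \<Omega> (\<lambda>x. u n x - v x))\<^sup>2
      + (L2_norm \<Omega> (\<lambda>x. weak_grad \<Omega> (u n) x - G x))\<^sup>2)" for n
  have e: "H1_norm \<Omega> (\<lambda>x. v x - u n x) = e n" for n
    using H1_norm_eq[OF is_weak_grad_diff[OF v L2(1) wG is_weak_grad_weak_grad[OF H10_H1[OF u]]], of n]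
    unfolding e_def by (simp add: L2_norm_minus_commute[of \<Omega> v] L2_norm_minus_commute[of \<Omega> G])
  have "e \<longlonglongrightarrow> sqrt (0\<^sup>2 + 0\<^sup>2)"
    unfolding e_def[abs_def] by (intro tendsto_intros lim_u lim_G)
  show "v \<in> H10 \<Omega>"
  proof (rule H10I[where \<phi> = \<phi> and e = "\<lambda>n. e n + inverse (real (Suc n))"])
    show "H1_norm \<Omega> (\<lambda>x. v x - \<phi> n x) \<le> e n + inverse (real (Suc n))" for n
      using H1_norm_triangle[of "\<lambda>x. v x - u n x" "\<lambda>x. u n x - \<phi> n x"] \<phi>[of n] e[of n]
      by (simp add: vH u H1_diff H10_H1 test_functions_H1)
    show "(\<lambda>n. e n + inverse (real (Suc n))) \<longlonglongrightarrow> 0"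
      using tendsto_add[OF \<open>e \<longlonglongrightarrow> _\<close> LIMSEQ_inverse_real_of_nat] by simp
  qed (use vH \<phi> in auto)
qed

subsection \<open>The Poincare--Friedrichs inequality\<close>

text \<open>
  Integrate \<open>\<phi>\<^sup>2\<close> by parts against \<open>1 = \<partial>\<^sub>b (x \<bullet> b)\<close> for a coordinate direction \<open>b\<close>: the linear
  function \<open>x \<bullet> b\<close> is bounded on \<open>\<Omega>\<close> and one factor \<open>\<phi>\<close> cancels.
\<close>
lemma Poincare_test_functions:
  assumes \<phi>: "\<phi> \<in> test_functions \<Omega>" and R: "0 \<le> R" "\<And>x. x \<in> \<Omega> \<Longrightarrow> norm x \<le> R"
  shows "L2_norm \<Omega> \<phi> \<le> 2 * R * L2_norm \<Omega> (grad \<phi>)"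
proof -
  obtain b :: 'a where b: "b \<in> Basis" using nonempty_Basis by blast
  define \<psi> where "\<psi> x = partial_deriv b \<phi> x * (x \<bullet> b)" for x
  note sm = test_functions_smooth[OF \<phi>]
  have \<psi>: "\<psi> \<in> test_functions \<Omega>"
    unfolding \<psi>_def[abs_def]
    by (intro test_functions_mult test_functions_partial_deriv \<phi> b smooth_linear)
  have "(L2_norm \<Omega> \<phi>)\<^sup>2 = (\<integral>x. (\<phi> x * \<phi> x) * partial_deriv b (\<lambda>x. x \<bullet> b) x \<partial>lebesgue_on \<Omega>)"
    using b by (simp add: L2_norm_square L2_inner_def partial_deriv_linear)
  also have "\<dots> = - (\<integral>x. partial_deriv b (\<lambda>x. \<phi> x * \<phi> x) x * (x \<bullet> b) \<partial>lebesgue_on \<Omega>)"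
    by (intro integration_by_parts \<Omega>_lmeasurable test_functions_mult \<phi> sm smooth_linear b)
  also have "(\<lambda>x. partial_deriv b (\<lambda>x. \<phi> x * \<phi> x) x * (x \<bullet> b)) = (\<lambda>x. 2 * (\<phi> x * \<psi> x))"
    by (simp add: partial_deriv_mult sm \<psi>_def algebra_simps)
  also have "- (\<integral>x. 2 * (\<phi> x * \<psi> x) \<partial>lebesgue_on \<Omega>) = - 2 * L2_inner \<Omega> \<phi> \<psi>"
    by (simp add: L2_inner_def)
  also have "\<dots> \<le> 2 * (L2_norm \<Omega> \<phi> * L2_norm \<Omega> \<psi>)"
    using L2_Cauchy_Schwarz[OF test_L2[OF \<phi>] test_L2[OF \<psi>]] by linarith
  also have "L2_norm \<Omega> \<psi> \<le> R * L2_norm \<Omega> (grad \<phi>)"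
  proof (rule L2_norm_mono[OF test_L2[OF \<psi>] grad_L2[OF \<phi>] R(1)], rule AE_I2)
    fix x assume "x \<in> space (lebesgue_on \<Omega>)"
    then have "x \<in> \<Omega>" by simp
    have "\<bar>x \<bullet> b\<bar> \<le> R" using Basis_le_norm[OF b, of x] R(2)[OF \<open>x \<in> \<Omega>\<close>] by linarith
    moreover have "\<bar>partial_deriv b \<phi> x\<bar> \<le> norm (grad \<phi> x)"
      using Basis_le_norm[OF b, of "grad \<phi> x"] by (simp add: grad_inner[OF b])
    ultimately have "\<bar>x \<bullet> b\<bar> * \<bar>partial_deriv b \<phi> x\<bar> \<le> R * norm (grad \<phi> x)"
      using R(1) by (intro mult_mono) auto
    then show "norm (\<psi> x) \<le> R * norm (grad \<phi> x)"
      by (simp add: \<psi>_def abs_mult mult.commute)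
  qed
  finally have "L2_norm \<Omega> \<phi> * L2_norm \<Omega> \<phi> \<le> L2_norm \<Omega> \<phi> * (2 * R * L2_norm \<Omega> (grad \<phi>))"
    by (simp add: power2_eq_square mult.left_commute mult.assoc mult_left_mono)
  then show ?thesis
    using R(1) L2_norm_nonneg[of \<Omega> \<phi>] by (cases "L2_norm \<Omega> \<phi> = 0") (auto simp: mult_le_cancel_left)
qed

text \<open>
  The bound for test functions carries over by density, at the price of an error that tends to zero.
\<close>
lemma Poincare:
  obtains C where "0 < C" "\<And>u. u \<in> H10 \<Omega> \<Longrightarrow> L2_norm \<Omega> u \<le> C * L2_norm \<Omega> (weak_grad \<Omega> u)"
proof -
  obtain R where R: "0 < R" "\<And>x. x \<in> \<Omega> \<Longrightarrow> norm x \<le> R"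
    using bounded_\<Omega> by (auto simp: bounded_pos)
  have "L2_norm \<Omega> u \<le> 2 * R * L2_norm \<Omega> (weak_grad \<Omega> u)" if u: "u \<in> H10 \<Omega>" for u
  proof -
    obtain \<phi> where \<phi>: "\<And>k::nat. \<phi> k \<in> test_functions \<Omega>" "(\<lambda>k. H1_norm \<Omega> (\<lambda>x. u x - \<phi> k x)) \<longlonglongrightarrow> 0"
      using H10_approx[OF u] by metis
    have uL: "u \<in> L2 \<Omega>" "weak_grad \<Omega> u \<in> L2 \<Omega>" using u by (auto intro: H10_L2 weak_grad_L2 H10_H1)
    have "L2_norm \<Omega> u \<le> 2 * R * L2_norm \<Omega> (weak_grad \<Omega> u)
        + (1 + 2 * R) * H1_norm \<Omega> (\<lambda>x. u x - \<phi> k x)" for k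
    proof -
      let ?d = "H1_norm \<Omega> (\<lambda>x. u x - \<phi> k x)"
      have wd: "is_weak_grad \<Omega> (\<lambda>x. u x - \<phi> k x) (\<lambda>x. weak_grad \<Omega> u x - grad (\<phi> k) x)"
        using u \<phi>(1) by (intro is_weak_grad_diff uL test_L2 is_weak_grad_weak_grad is_weak_grad_grad H10_H1)
      have "L2_norm \<Omega> (grad (\<phi> k)) \<le> L2_norm \<Omega> (weak_grad \<Omega> u)
          + L2_norm \<Omega> (\<lambda>x. weak_grad \<Omega> u x - grad (\<phi> k) x)"
        using L2_norm_triangle_sub[OF grad_L2[OF \<phi>(1)] uL(2)]
        by (simp add: L2_norm_minus_commute[of \<Omega> "grad (\<phi> _)"])
      also have "L2_norm \<Omega> (\<lambda>x. weak_grad \<Omega> u x - grad (\<phi> k) x) \<le> ?d"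
        using weak_grad_norm_le_H1_norm[of \<Omega> "\<lambda>x. u x - \<phi> k x"] by (simp add: weak_grad_norm_eq[OF wd])
      finally have "2 * R * L2_norm \<Omega> (grad (\<phi> k)) \<le> 2 * R * (L2_norm \<Omega> (weak_grad \<Omega> u) + ?d)"
        using R(1) by simp
      moreover have "L2_norm \<Omega> (\<phi> k) \<le> 2 * R * L2_norm \<Omega> (grad (\<phi> k))"
        using R by (intro Poincare_test_functions \<phi>) auto
      moreover have "L2_norm \<Omega> u \<le> L2_norm \<Omega> (\<phi> k) + ?d"
        using L2_norm_triangle_sub[OF uL(1) test_L2[OF \<phi>(1)], of k]
          L2_norm_le_H1_norm[of \<Omega> "\<lambda>x. u x - \<phi> k x"] by linarith
      ultimately show ?thesis by (simp add: algebra_simps)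
    qed
    moreover have "(\<lambda>k. 2 * R * L2_norm \<Omega> (weak_grad \<Omega> u)
        + (1 + 2 * R) * H1_norm \<Omega> (\<lambda>x. u x - \<phi> k x))
        \<longlonglongrightarrow> 2 * R * L2_norm \<Omega> (weak_grad \<Omega> u) + (1 + 2 * R) * 0"
      by (intro tendsto_intros \<phi>(2))
    ultimately show ?thesis
      using LIMSEQ_le_const[of _ _ "L2_norm \<Omega> u"] by fastforce
  qed
  then show ?thesis using R(1) by (intro that[of "2 * R"]) auto
qed

section \<open>The obstacle problem\<close>

lemma weak_div_eq: "is_weak_grad \<Omega> v G \<Longrightarrow> \<sigma> \<in> L2 \<Omega> \<Longrightarrow> weak_div \<Omega> \<sigma> v = - L2_inner \<Omega> \<sigma> G"
  by (simp add: weak_div_def weak_grad_inner_eq)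

lemma weak_div_diff:
  assumes "\<sigma> \<in> L2 \<Omega>" "\<tau> \<in> L2 \<Omega>" "v \<in> H10 \<Omega>"
  shows "weak_div \<Omega> (\<lambda>x. \<sigma> x - \<tau> x) v = weak_div \<Omega> \<sigma> v - weak_div \<Omega> \<tau> v"
  using assms by (simp add: weak_div_def L2_inner_diff_left weak_grad_L2 H10_H1)

lemma Hm1_add: "F \<in> Hm1 \<Omega> \<Longrightarrow> v \<in> H10 \<Omega> \<Longrightarrow> w \<in> H10 \<Omega> \<Longrightarrow> F (\<lambda>x. v x + w x) = F v + F w"
  by (simp add: Hm1_def)

lemma Hm1_mult: "F \<in> Hm1 \<Omega> \<Longrightarrow> v \<in> H10 \<Omega> \<Longrightarrow> F (\<lambda>x. c * v x) = c * F v"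
  by (simp add: Hm1_def)

lemma Hm1_diff:
  assumes "F \<in> Hm1 \<Omega>" "v \<in> H10 \<Omega>" "w \<in> H10 \<Omega>"
  shows "F (\<lambda>x. v x - w x) = F v - F w"
  using Hm1_add[OF assms(1,2) H10_mult[OF assms(3), of "-1"]] Hm1_mult[OF assms(1,3), of "-1"]
  by simp

lemma L2_density_props:
  assumes "dual_in_L2 \<Omega> F"
  shows "L2_density \<Omega> F \<in> L2 \<Omega>" "dual_eq \<Omega> F (L2_inner \<Omega> (L2_density \<Omega> F))"
proof -
  have "\<exists>h. h \<in> L2 \<Omega> \<and> dual_eq \<Omega> F (L2_inner \<Omega> h)" using assms by (auto simp: dual_in_L2_def)
  then have "L2_density \<Omega> F \<in> L2 \<Omega> \<and> dual_eq \<Omega> F (L2_inner \<Omega> (L2_density \<Omega> F))"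
    unfolding L2_density_def by (rule someI_ex)
  then show "L2_density \<Omega> F \<in> L2 \<Omega>" "dual_eq \<Omega> F (L2_inner \<Omega> (L2_density \<Omega> F))" by auto
qed

text \<open>
  Test functions are admissible arguments of the functional, so the fundamental lemma applies.
\<close>
lemma L2_density_eq:
  assumes "h \<in> L2 \<Omega>" "dual_eq \<Omega> F (L2_inner \<Omega> h)"
  shows "AE_eq \<Omega> (L2_density \<Omega> F) h"
proof -
  have d: "L2_density \<Omega> F \<in> L2 \<Omega>" "dual_eq \<Omega> F (L2_inner \<Omega> (L2_density \<Omega> F))"
    using assms by (auto intro!: L2_density_props simp: dual_in_L2_def)
  have "AE x in lebesgue_on \<Omega>. L2_density \<Omega> F x - h x = 0"
  proof (rule fundamental_lemma)
    fix \<phi> assume \<phi>: "\<phi> \<in> test_functions \<Omega>"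
    then have "L2_inner \<Omega> (L2_density \<Omega> F) \<phi> = L2_inner \<Omega> h \<phi>"
      using d(2) assms(2) test_functions_H10 unfolding dual_eq_def by metis
    then show "L2_inner \<Omega> (\<lambda>x. L2_density \<Omega> F x - h x) \<phi> = 0"
      using d assms \<phi> by (simp add: L2_inner_diff_left test_L2)
  qed (use d assms in auto)
  then show ?thesis by (simp add: AE_eq_def)
qed

subsection \<open>Solvability of the variational inequality\<close>

text \<open>
  Where \<open>u n\<close> is nonnegative, the negative part of \<open>v\<close> is at most \<open>\<bar>u n - v\<bar>\<close>; its norm is therefore
  below every \<open>\<parallel>u n - v\<parallel>\<close>.
\<close>
lemma AE_nonneg_closed:
  assumes u: "\<And>n. u n \<in> L2 \<Omega>" "v \<in> L2 \<Omega>" "(\<lambda>n::nat. L2_norm \<Omega> (\<lambda>x. u n x - v x)) \<longlonglongrightarrow> 0"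
    and nonneg: "\<And>n. AE_nonneg \<Omega> (u n)"
  shows "AE_nonneg \<Omega> v"
proof -
  define N where "N x = max 0 (- v x)" for x
  note [measurable] = L2_measurable[OF u(2)]
  have "N \<in> borel_measurable (lebesgue_on \<Omega>)" unfolding N_def[abs_def] by measurable
  then have N: "N \<in> L2 \<Omega>"
    by (rule L2_bound[OF _ L2_square_integrable[OF u(2)]]) (auto simp: N_def max_def)
  have "L2_norm \<Omega> N \<le> L2_norm \<Omega> (\<lambda>x. u n x - v x)" for n
  proof -
    have "AE x in lebesgue_on \<Omega>. norm (N x) \<le> 1 * norm (u n x - v x)"
      using nonneg[of n] unfolding AE_nonneg_def by eventually_elim (auto simp: N_def)
    then show ?thesis using L2_norm_mono[OF N L2_diff[OF u(1,2)], of 1] by simp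
  qed
  then have "L2_norm \<Omega> N \<le> 0"
    using LIMSEQ_le_const[OF u(3)] by blast
  then have "L2_norm \<Omega> N = 0" using L2_norm_nonneg[of \<Omega> N] by linarith
  then have "AE x in lebesgue_on \<Omega>. N x = 0" using L2_norm_eq_0_iff[OF N] by blast
  then show ?thesis
    unfolding AE_nonneg_def by eventually_elim (auto simp: N_def max_def split: if_splits)
qed

definition admissible :: "('a \<Rightarrow> real) \<Rightarrow> ('a \<Rightarrow> real) set" where
  "admissible g = {v \<in> H10 \<Omega>. AE_nonneg \<Omega> (\<lambda>x. v x - g x)}"

lemma admissibleD: "v \<in> admissible g \<Longrightarrow> AE x in lebesgue_on \<Omega>. 0 \<le> v x - g x"
  by (simp add: admissible_def AE_nonneg_def)

definition energy :: "('a \<Rightarrow> real) \<Rightarrow> ('a \<Rightarrow> real) \<Rightarrow> real" where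
  "energy f v = (L2_norm \<Omega> (weak_grad \<Omega> v))\<^sup>2 / 2 - L2_inner \<Omega> f v"

lemma admissible_convex:
  assumes "u \<in> admissible g" "v \<in> admissible g" "0 \<le> t" "t \<le> 1"
  shows "(\<lambda>x. u x + t * (v x - u x)) \<in> admissible g"
proof -
  have "AE_nonneg \<Omega> (\<lambda>x. (u x + t * (v x - u x)) - g x)"
    using admissibleD[OF assms(1)] admissibleD[OF assms(2)] unfolding AE_nonneg_def
  proof eventually_elim
    case (elim x)
    then have "0 \<le> (1 - t) * (u x - g x) + t * (v x - g x)" using assms by simp
    then show ?case by (simp add: algebra_simps)
  qed
  then show ?thesis using assms by (auto simp: admissible_def intro!: H10_add H10_mult H10_diff)
qed

lemma energy_along_line:
  assumes f: "f \<in> L2 \<Omega>" and u: "u \<in> H10 \<Omega>" and d: "d \<in> H10 \<Omega>"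
  shows "energy f (\<lambda>x. u x + t * d x) = energy f u
    + t * (L2_inner \<Omega> (weak_grad \<Omega> u) (weak_grad \<Omega> d) - L2_inner \<Omega> f d)
    + t\<^sup>2 / 2 * (L2_norm \<Omega> (weak_grad \<Omega> d))\<^sup>2"
proof -
  have L2: "u \<in> L2 \<Omega>" "d \<in> L2 \<Omega>" "weak_grad \<Omega> u \<in> L2 \<Omega>" "weak_grad \<Omega> d \<in> L2 \<Omega>"
    using u d by (auto intro: H10_L2 weak_grad_L2 H10_H1)
  have "is_weak_grad \<Omega> (\<lambda>x. u x + t * d x) (\<lambda>x. weak_grad \<Omega> u x + t *\<^sub>R weak_grad \<Omega> d x)"
    using u d by (intro is_weak_grad_add is_weak_grad_mult is_weak_grad_weak_grad L2 L2_mult H10_H1)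
  from weak_grad_norm_eq[OF this] show ?thesis
    using L2 f
    by (simp add: energy_def L2_norm_square_add L2_scaleR L2_inner_linear L2_mult L2_norm_scaleR
        power_mult_distrib) (simp add: field_simps)
qed

lemma energy_parallelogram:
  assumes f: "f \<in> L2 \<Omega>" and u: "u \<in> H10 \<Omega>" and v: "v \<in> H10 \<Omega>"
  shows "(L2_norm \<Omega> (weak_grad \<Omega> (\<lambda>x. u x - v x)))\<^sup>2
    = 4 * (energy f u + energy f v - 2 * energy f (\<lambda>x. v x + 1 / 2 * (u x - v x)))"
proof -
  define d where "d x = u x - v x" for x
  have d: "d \<in> H10 \<Omega>" unfolding d_def[abs_def] using u v by auto
  have "energy f u = energy f (\<lambda>x. v x + 1 * d x)" by (simp add: d_def)
  then show ?thesis
    using energy_along_line[OF f v d, of 1] energy_along_line[OF f v d, of "1/2"]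
    by (simp add: d_def[symmetric] d_def[abs_def, symmetric] field_simps power2_eq_square)
qed

text \<open>
  By the Poincare inequality the linear part is at most \<open>\<parallel>f\<parallel> C \<parallel>\<nabla>v\<parallel>\<close>, which the quadratic part absorbs.
\<close>
lemma energy_bounded_below:
  assumes f: "f \<in> L2 \<Omega>"
  obtains m where "\<And>v. v \<in> H10 \<Omega> \<Longrightarrow> m \<le> energy f v"
proof -
  obtain C where C: "0 < C" "\<And>u. u \<in> H10 \<Omega> \<Longrightarrow> L2_norm \<Omega> u \<le> C * L2_norm \<Omega> (weak_grad \<Omega> u)"
    using Poincare by metis
  have "- (L2_norm \<Omega> f * C)\<^sup>2 / 2 \<le> energy f v" if v: "v \<in> H10 \<Omega>" for v
  proof -
    let ?a = "L2_norm \<Omega> (weak_grad \<Omega> v)"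
    have "L2_inner \<Omega> f v \<le> L2_norm \<Omega> f * L2_norm \<Omega> v"
      using L2_Cauchy_Schwarz[OF f H10_L2[OF v]] by linarith
    also have "\<dots> \<le> L2_norm \<Omega> f * (C * ?a)" by (intro mult_left_mono C v) simp
    finally have "L2_inner \<Omega> f v \<le> (L2_norm \<Omega> f * C) * ?a" by simp
    moreover have "2 * (L2_norm \<Omega> f * C) * ?a \<le> (L2_norm \<Omega> f * C)\<^sup>2 + ?a\<^sup>2"
      by (rule sum_squares_bound)
    ultimately show ?thesis by (simp add: energy_def)
  qed
  then show ?thesis by (rule that)
qed

text \<open>
  The midpoint of two members of a minimizing sequence is again a competitor, so the parallelogram
  identity makes the gradients Cauchy, and the Poincare inequality the functions themselves.
\<close>
lemma energy_minimizer:
  assumes f: "f \<in> L2 \<Omega>" and g: "g \<in> H10 \<Omega>"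
  obtains u where "u \<in> admissible g" "\<And>v. v \<in> admissible g \<Longrightarrow> energy f u \<le> energy f v"
proof -
  obtain C where C: "0 < C" "\<And>u. u \<in> H10 \<Omega> \<Longrightarrow> L2_norm \<Omega> u \<le> C * L2_norm \<Omega> (weak_grad \<Omega> u)"
    using Poincare by metis
  define K where "K = admissible g"
  have K_H10: "v \<in> H10 \<Omega>" if "v \<in> K" for v using that by (simp add: K_def admissible_def)
  have "g \<in> K" using g by (simp add: K_def admissible_def AE_nonneg_def)
  define m where "m = Inf (energy f ` K)"
  obtain m0 where "\<And>v. v \<in> H10 \<Omega> \<Longrightarrow> m0 \<le> energy f v" using energy_bounded_below[OF f] by metis
  then have bdd: "bdd_below (energy f ` K)" using K_H10 by (auto simp: bdd_below_def)
  then have m: "m \<le> energy f v" if "v \<in> K" for v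
    unfolding m_def using that by (intro cInf_lower) auto
  have "\<exists>v\<in>K. energy f v < m + inverse (real (Suc n))" for n
  proof -
    have "Inf (energy f ` K) < m + inverse (real (Suc n))" by (simp add: m_def)
    from cInf_lessD[OF _ this] show ?thesis using \<open>g \<in> K\<close> by auto
  qed
  then obtain u where u: "\<And>n. u n \<in> K" "\<And>n. energy f (u n) < m + inverse (real (Suc n))" by metis
  have uH: "u n \<in> H10 \<Omega>" for n using K_H10[OF u(1)] .
  have L2: "u n \<in> L2 \<Omega>" "weak_grad \<Omega> (u n) \<in> L2 \<Omega>" for n
    using uH by (auto intro: H10_L2 weak_grad_L2 H10_H1)
  have Cauchy: "\<exists>N. \<forall>j\<ge>N. \<forall>k\<ge>N. L2_norm \<Omega> (weak_grad \<Omega> (\<lambda>x. u j x - u k x)) < e"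
    if "0 < e" for e
  proof -
    obtain N where N: "inverse (real (Suc N)) < e\<^sup>2 / 8"
      using reals_Archimedean[of "e\<^sup>2 / 8"] \<open>0 < e\<close> by auto
    have "L2_norm \<Omega> (weak_grad \<Omega> (\<lambda>x. u j x - u k x)) < e" if "j \<ge> N" "k \<ge> N" for j k
    proof -
      have small: "energy f (u i) < m + e\<^sup>2 / 8" if "i \<ge> N" for i
      proof -
        have "inverse (real (Suc i)) \<le> inverse (real (Suc N))" using that by simp
        then show ?thesis using u(2)[of i] N by linarith
      qed
      have "(\<lambda>x. u k x + 1 / 2 * (u j x - u k x)) \<in> K"
        using u(1) unfolding K_def by (intro admissible_convex) auto
      note mid = m[OF this]
      have "X = 4 * (a + b - 2 * c) \<Longrightarrow> a < m + s / 8 \<Longrightarrow> b < m + s / 8 \<Longrightarrow> m \<le> c \<Longrightarrow> X < s"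
        for X a b c s :: real
        by (simp add: algebra_simps)
      from this[OF energy_parallelogram[OF f uH[of j] uH[of k]]
          small[OF \<open>j \<ge> N\<close>] small[OF \<open>k \<ge> N\<close>] mid]
      have "(L2_norm \<Omega> (weak_grad \<Omega> (\<lambda>x. u j x - u k x)))\<^sup>2 < e\<^sup>2" .
      then show ?thesis using \<open>0 < e\<close> by (intro power2_less_imp_less[of _ e]) auto
    qed
    then show ?thesis by blast
  qed
  have Cauchy_grad: "\<exists>N. \<forall>j\<ge>N. \<forall>k\<ge>N.
      L2_norm \<Omega> (\<lambda>x. weak_grad \<Omega> (u j) x - weak_grad \<Omega> (u k) x) < e" if "0 < e" for e
    using Cauchy[OF that]
    by (simp add: weak_grad_norm_eq[OF is_weak_grad_weak_grad_diff[OF H10_H1[OF uH] H10_H1[OF uH]]])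
  have Cauchy_L2: "\<exists>N. \<forall>j\<ge>N. \<forall>k\<ge>N. L2_norm \<Omega> (\<lambda>x. u j x - u k x) < e" if "0 < e" for e
  proof -
    obtain N where N: "\<And>j k. j \<ge> N \<Longrightarrow> k \<ge> N \<Longrightarrow>
        L2_norm \<Omega> (weak_grad \<Omega> (\<lambda>x. u j x - u k x)) < e / C"
      using Cauchy[of "e / C"] \<open>0 < e\<close> C(1) by auto
    have "L2_norm \<Omega> (\<lambda>x. u j x - u k x) < e" if "j \<ge> N" "k \<ge> N" for j k
    proof -
      have "L2_norm \<Omega> (\<lambda>x. u j x - u k x) \<le> C * L2_norm \<Omega> (weak_grad \<Omega> (\<lambda>x. u j x - u k x))"
        by (intro C H10_diff uH)
      also have "\<dots> < C * (e / C)" using N[OF that] C(1) by (intro mult_strict_left_mono)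
      finally show ?thesis using C(1) by simp
    qed
    then show ?thesis by blast
  qed
  obtain v where v: "v \<in> L2 \<Omega>" "(\<lambda>n. L2_norm \<Omega> (\<lambda>x. u n x - v x)) \<longlonglongrightarrow> 0"
    using L2_complete[OF \<Omega>_lmeasurable L2(1) Cauchy_L2] by metis
  obtain G where G: "G \<in> L2 \<Omega>" "(\<lambda>n. L2_norm \<Omega> (\<lambda>x. weak_grad \<Omega> (u n) x - G x)) \<longlonglongrightarrow> 0"
    using L2_complete[of \<Omega> "\<lambda>n. weak_grad \<Omega> (u n)", OF \<Omega>_lmeasurable L2(2) Cauchy_grad] by metis
  note vH = H10_closed[OF uH v(1) G(1) v(2) G(2)]
  have "AE_nonneg \<Omega> (\<lambda>x. v x - g x)"
  proof (rule AE_nonneg_closed[where u = "\<lambda>n x. u n x - g x"])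
    show "AE_nonneg \<Omega> (\<lambda>x. u n x - g x)" for n using u(1) by (simp add: K_def admissible_def)
  qed (use v L2 H10_L2[OF g] in auto)
  then have "v \<in> K" using vH by (simp add: K_def admissible_def)
  have "(\<lambda>n. energy f (u n)) \<longlonglongrightarrow> (L2_norm \<Omega> G)\<^sup>2 / 2 - L2_inner \<Omega> f v"
    unfolding energy_def L2_inner_commute[of \<Omega> f]
    by (intro tendsto_intros L2_norm_tendsto L2_inner_tendsto L2 v G f) auto
  then have "(\<lambda>n. energy f (u n)) \<longlonglongrightarrow> energy f v"
    by (simp add: energy_def weak_grad_norm_eq[OF vH(2)])
  moreover have "(\<lambda>n. m + inverse (real (Suc n))) \<longlonglongrightarrow> m + 0"
    by (intro tendsto_intros LIMSEQ_inverse_real_of_nat)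
  ultimately have "energy f v \<le> m"
    using u(2) by (intro LIMSEQ_le[of _ "energy f v" _ m]) (auto intro: less_imp_le)
  then show ?thesis
    using \<open>v \<in> K\<close> m by (intro that[of v]) (force simp: K_def)+
qed

text \<open>
  The energy along the segment from \<open>u\<close> to \<open>v\<close> is a quadratic polynomial in \<open>t\<close> that is minimal at
  \<open>t = 0\<close>, so its slope there is nonnegative.
\<close>
lemma variational_inequality:
  assumes f: "f \<in> L2 \<Omega>" and g: "g \<in> H10 \<Omega>"
  obtains u where "u \<in> admissible g"
    "\<And>v. v \<in> admissible g \<Longrightarrow> L2_inner \<Omega> f (\<lambda>x. v x - u x)
      \<le> L2_inner \<Omega> (weak_grad \<Omega> u) (weak_grad \<Omega> (\<lambda>x. v x - u x))"
proof -
  obtain u where u: "u \<in> admissible g" "\<And>v. v \<in> admissible g \<Longrightarrow> energy f u \<le> energy f v"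
    using energy_minimizer[OF f g] by metis
  have uH: "u \<in> H10 \<Omega>" using u(1) by (simp add: admissible_def)
  have "L2_inner \<Omega> f (\<lambda>x. v x - u x) \<le> L2_inner \<Omega> (weak_grad \<Omega> u) (weak_grad \<Omega> (\<lambda>x. v x - u x))"
    if v: "v \<in> admissible g" for v
  proof (rule ccontr)
    define d where "d x = v x - u x" for x
    define B where "B = L2_inner \<Omega> f d - L2_inner \<Omega> (weak_grad \<Omega> u) (weak_grad \<Omega> d)"
    define D where "D = (L2_norm \<Omega> (weak_grad \<Omega> d))\<^sup>2"
    have d: "d \<in> H10 \<Omega>" unfolding d_def[abs_def] using v uH by (auto simp: admissible_def)
    assume "\<not> ?thesis"
    then have "0 < B" by (simp add: B_def d_def[abs_def])
    have "0 \<le> D" by (simp add: D_def)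
    \<comment> \<open>Small enough for the linear term \<open>- t B\<close> to beat \<open>t\<^sup>2 D / 2\<close>; the summand 1 avoids division by zero.\<close>
    define t where "t = min 1 (B / (D + 1))"
    have t: "0 < t" "t \<le> 1" "t * D < 2 * B"
    proof -
      have "t \<le> B / (D + 1)" by (simp add: t_def)
      then have "t * (D + 1) \<le> B" using \<open>0 \<le> D\<close> by (simp add: pos_le_divide_eq)
      then have "t * D + t \<le> B" by (simp add: distrib_left)
      moreover show "0 < t" "t \<le> 1" using \<open>0 < B\<close> \<open>0 \<le> D\<close> by (auto simp: t_def)
      ultimately show "t * D < 2 * B" using \<open>0 < B\<close> by linarith
    qed
    have "energy f u \<le> energy f (\<lambda>x. u x + t * d x)"
      unfolding d_def using t by (intro u admissible_convex v) auto
    then have "0 \<le> t * (t * D / 2 - B)"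
      using energy_along_line[OF f uH d, of t]
      by (simp add: B_def D_def algebra_simps power2_eq_square)
    then show False using t by (simp add: zero_le_mult_iff)
  qed
  then show ?thesis using u(1) by (intro that)
qed

subsection \<open>Existence for the first-order system\<close>

text \<open>
  The multiplier is the defect \<open>\<lambda> = - div (\<nabla>u) - f\<close> of the minimizer \<open>u\<close>, so the variational
  inequality reads \<open>\<langle>\<lambda>, v - u\<rangle> \<ge> 0\<close>. The competitors \<open>u + v\<close> with \<open>v \<ge> 0\<close> give the sign of \<open>\<lambda>\<close>;
  \<open>g\<close> and \<open>2 u - g\<close> give complementarity.
\<close>
lemma exists_FO_solution:
  assumes f: "f \<in> L2 \<Omega>" and g: "g \<in> H10 \<Omega>"
  shows "\<exists>u. FO_solution \<Omega> f g u"
proof -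
  obtain u where u: "u \<in> admissible g"
    and VI: "\<And>v. v \<in> admissible g \<Longrightarrow> L2_inner \<Omega> f (\<lambda>x. v x - u x)
      \<le> L2_inner \<Omega> (weak_grad \<Omega> u) (weak_grad \<Omega> (\<lambda>x. v x - u x))"
    using variational_inequality[OF f g] by metis
  define G where "G = weak_grad \<Omega> u"
  define l where "l v = L2_inner \<Omega> G (weak_grad \<Omega> v) - L2_inner \<Omega> f v" for v
  have uH: "u \<in> H10 \<Omega>" using u by (simp add: admissible_def)
  have G: "G \<in> L2 \<Omega>" unfolding G_def using uH by (intro weak_grad_L2 H10_H1)
  have VI': "0 \<le> l (\<lambda>x. v x - u x)" if "v \<in> admissible g" for v
    using VI[OF that] by (simp add: l_def G_def)
  have l_mult: "l (\<lambda>x. c * v x) = c * l v" if "v \<in> H10 \<Omega>" for c v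
    unfolding l_def
    using weak_grad_inner_eq[OF is_weak_grad_mult[OF is_weak_grad_weak_grad[OF H10_H1[OF that]]] G]
    by (simp add: L2_inner_scaleR_right L2_inner_mult_right right_diff_distrib)
  have "l \<in> Hm1 \<Omega>"
    unfolding Hm1_def
  proof (intro CollectI conjI ballI allI)
    fix v w assume vw: "v \<in> H10 \<Omega>" "w \<in> H10 \<Omega>"
    show "l (\<lambda>x. v x + w x) = l v + l w"
      unfolding l_def
      using weak_grad_inner_eq[OF is_weak_grad_weak_grad_add[OF H10_H1 H10_H1] G, OF vw] vw
      by (simp add: L2_inner_add_right f G H10_L2 weak_grad_L2 H10_H1)
  next
    show "\<exists>C. \<forall>v\<in>H10 \<Omega>. \<bar>l v\<bar> \<le> C * H1_norm \<Omega> v"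
    proof (intro exI ballI)
      fix v assume v: "v \<in> H10 \<Omega>"
      have "\<bar>l v\<bar> \<le> \<bar>L2_inner \<Omega> G (weak_grad \<Omega> v)\<bar> + \<bar>L2_inner \<Omega> f v\<bar>"
        unfolding l_def by linarith
      also have "\<dots> \<le> L2_norm \<Omega> G * L2_norm \<Omega> (weak_grad \<Omega> v) + L2_norm \<Omega> f * L2_norm \<Omega> v"
        by (intro add_mono L2_Cauchy_Schwarz G f weak_grad_L2 H10_H1 H10_L2 v)
      also have "\<dots> \<le> L2_norm \<Omega> G * H1_norm \<Omega> v + L2_norm \<Omega> f * H1_norm \<Omega> v"
        by (intro add_mono mult_left_mono weak_grad_norm_le_H1_norm L2_norm_le_H1_norm L2_norm_nonneg)
      finally show "\<bar>l v\<bar> \<le> (L2_norm \<Omega> G + L2_norm \<Omega> f) * H1_norm \<Omega> v"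
        by (simp add: algebra_simps)
    qed
  qed (rule l_mult)
  moreover have residual: "weak_div \<Omega> G v + l v = - L2_inner \<Omega> f v" for v
    by (simp add: weak_div_def l_def)
  then have "dual_in_L2 \<Omega> (\<lambda>v. weak_div \<Omega> G v + l v)"
    unfolding dual_in_L2_def dual_eq_def using f
    by (intro bexI[of _ "\<lambda>x. - f x"]) (auto simp: L2_inner_minus_left)
  ultimately have "(u, G, l) \<in> U \<Omega>" using uH G by (simp add: U_def)
  moreover have "dual_nonneg \<Omega> l"
    unfolding dual_nonneg_def
  proof (intro ballI impI)
    fix v assume v: "v \<in> H10 \<Omega>" "AE_nonneg \<Omega> v"
    have "AE_nonneg \<Omega> (\<lambda>x. (u x + v x) - g x)"
      using admissibleD[OF u] v(2) unfolding AE_nonneg_def by eventually_elim simp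
    then have "(\<lambda>x. u x + v x) \<in> admissible g" using uH v by (auto simp: admissible_def)
    from VI'[OF this] show "0 \<le> l v" by simp
  qed
  moreover have "l (\<lambda>x. u x - g x) = 0"
  proof (rule antisym)
    have "g \<in> admissible g" using g by (simp add: admissible_def AE_nonneg_def)
    from VI'[OF this] show "l (\<lambda>x. u x - g x) \<le> 0"
      using l_mult[OF H10_diff[OF uH g], of "-1"] by (simp add: algebra_simps)
    have "AE_nonneg \<Omega> (\<lambda>x. (2 * u x - g x) - g x)"
      using admissibleD[OF u] unfolding AE_nonneg_def by eventually_elim simp
    then have "(\<lambda>x. 2 * u x - g x) \<in> admissible g" using uH g by (auto simp: admissible_def)
    from VI'[OF this] show "0 \<le> l (\<lambda>x. u x - g x)" by (simp add: algebra_simps)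
  qed
  moreover have "AE_nonneg \<Omega> (\<lambda>x. u x - g x)" using u by (simp add: admissible_def)
  moreover have "dual_eq \<Omega> (\<lambda>v. - weak_div \<Omega> G v - l v) (L2_inner \<Omega> f)"
    unfolding dual_eq_def using residual by (metis add_uminus_conv_diff minus_add_distrib minus_minus)
  ultimately have "FO_solution \<Omega> f g (u, G, l)"
    by (simp add: FO_solution_def AE_eq_def G_def)
  then show ?thesis ..
qed

end

section \<open>Equivalence and coercivity\<close>

text \<open>
  Here \<open>a\<close>, \<open>c\<close> and \<open>A\<close> are the norms of \<open>\<nabla>w\<close>, \<open>\<rho>\<close> and \<open>h\<close> for a difference \<open>(w, \<rho>, \<nu>)\<close> of triples with
  \<open>h = div \<rho> + \<nu>\<close>; \<open>p = (\<rho>, \<nabla>w)\<close>, \<open>q = (h, w)\<close>, and \<open>X\<close> is the complementarity term. Only the fraction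
  \<open>t (p + q)\<close> of the lower bound for \<open>X\<close> is used, so that \<open>t q\<close> can be absorbed by \<open>A\<^sup>2 / 2\<close> and
  \<open>t a\<^sup>2 / 4\<close> however large the constant \<open>C\<close> is.
\<close>
lemma coercive_quadratic:
  fixes a c A p q X C t :: real
  assumes "0 \<le> a" "0 \<le> c" "0 \<le> A" "0 < C"
    and p: "\<bar>p\<bar> \<le> a * c" and q: "\<bar>q\<bar> \<le> A * (C * a)" and X: "0 \<le> X" "p + q \<le> X"
    and t: "0 \<le> t" "t \<le> 1" "t * C\<^sup>2 \<le> 1 / 2"
  shows "t / 4 * (a\<^sup>2 + c\<^sup>2 + A\<^sup>2) \<le> A\<^sup>2 + (a\<^sup>2 - 2 * p + c\<^sup>2) + X"
proof -
  have "t * (p + q) \<le> t * X" using X t by (intro mult_left_mono)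
  also have "\<dots> \<le> X" using X t by (simp add: mult_left_le_one_le)
  finally have 1: "t * (p + q) \<le> X" .
  have "2 * p \<le> a\<^sup>2 + c\<^sup>2" using p sum_squares_bound[of a c] by linarith
  then have "(2 - t) * (2 * p) \<le> (2 - t) * (a\<^sup>2 + c\<^sup>2)" using t by (intro mult_left_mono) auto
  then have 2: "t / 2 * (a\<^sup>2 + c\<^sup>2) \<le> a\<^sup>2 - 2 * p + c\<^sup>2 + t * p" by (simp add: algebra_simps)
  have "A * (C * a) \<le> a\<^sup>2 / 4 + C\<^sup>2 * A\<^sup>2"
    using sum_squares_bound[of "a / 2" "C * A"] by (simp add: power_mult_distrib power_divide algebra_simps)
  then have "- q \<le> a\<^sup>2 / 4 + C\<^sup>2 * A\<^sup>2" using q by linarith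
  then have "t * - q \<le> t * (a\<^sup>2 / 4 + C\<^sup>2 * A\<^sup>2)" using t by (intro mult_left_mono)
  also have "\<dots> = t / 4 * a\<^sup>2 + (t * C\<^sup>2) * A\<^sup>2" by (simp add: algebra_simps)
  also have "\<dots> \<le> t / 4 * a\<^sup>2 + 1 / 2 * A\<^sup>2" using t by (intro add_left_mono mult_right_mono) auto
  finally have 3: "- (t / 4 * a\<^sup>2) - A\<^sup>2 / 2 \<le> t * q" by simp
  have 4: "t / 4 * A\<^sup>2 \<le> A\<^sup>2 / 2" "0 \<le> t / 4 * c\<^sup>2"
    using t mult_right_mono[of "t / 4" "1 / 2" "A\<^sup>2"] by auto
  from 1 2 3 4 show ?thesis by (simp add: algebra_simps)
qed
context bounded_open_set
begin

lemma Ks_dest: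
  assumes "(u, \<sigma>, l) \<in> Ks \<Omega> g"
  shows "u \<in> H10 \<Omega>" "\<sigma> \<in> L2 \<Omega>" "l \<in> Hm1 \<Omega>" "AE_nonneg \<Omega> (\<lambda>x. u x - g x)" "dual_nonneg \<Omega> l"
    "dual_in_L2 \<Omega> (\<lambda>v. weak_div \<Omega> \<sigma> v + l v)"
  using assms by (auto simp: Ks_def U_def)

lemma FO_solution_Ks: "FO_solution \<Omega> f g u \<Longrightarrow> u \<in> Ks \<Omega> g"
  by (auto simp: FO_solution_def Ks_def)

lemma complementarity_nonneg:
  assumes "(u, \<sigma>, l) \<in> Ks \<Omega> g" "g \<in> H10 \<Omega>"
  shows "0 \<le> l (\<lambda>x. u x - g x)"
  using Ks_dest[OF assms(1)] assms(2) by (auto simp: dual_nonneg_def)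

lemma J_nonneg:
  assumes "w \<in> Ks \<Omega> g" "g \<in> H10 \<Omega>"
  shows "0 \<le> J \<Omega> f g w"
  using complementarity_nonneg[of "fst w" "fst (snd w)" "snd (snd w)" g] assms
  by (auto simp: J_def split: prod.split)

text \<open>
  Each of the three nonnegative terms expresses one equation of the system.
\<close>
lemma FO_iff_J_eq_0:
  assumes f: "f \<in> L2 \<Omega>" and g: "g \<in> H10 \<Omega>" and w: "(u, \<sigma>, l) \<in> Ks \<Omega> g"
  shows "FO_solution \<Omega> f g (u, \<sigma>, l) \<longleftrightarrow> J \<Omega> f g (u, \<sigma>, l) = 0"
proof -
  note K = Ks_dest[OF w]
  define d where "d = L2_density \<Omega> (\<lambda>v. weak_div \<Omega> \<sigma> v + l v)"
  have d: "d \<in> L2 \<Omega>" "\<And>v. v \<in> H10 \<Omega> \<Longrightarrow> weak_div \<Omega> \<sigma> v + l v = L2_inner \<Omega> d v"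
    using L2_density_props[OF K(6)] by (auto simp: d_def dual_eq_def)
  have G: "weak_grad \<Omega> u \<in> L2 \<Omega>" using K by (intro weak_grad_L2 H10_H1)
  have "J \<Omega> f g (u, \<sigma>, l) = 0 \<longleftrightarrow> L2_norm \<Omega> (\<lambda>x. d x + f x) = 0
      \<and> L2_norm \<Omega> (\<lambda>x. weak_grad \<Omega> u x - \<sigma> x) = 0 \<and> l (\<lambda>x. u x - g x) = 0"
    using complementarity_nonneg[OF w g] by (auto simp: J_def d_def add_nonneg_eq_0_iff)
  also have "L2_norm \<Omega> (\<lambda>x. d x + f x) = 0 \<longleftrightarrow> AE_eq \<Omega> d (\<lambda>x. - f x)"
    using L2_norm_eq_0_iff[OF L2_add[OF d(1) f]] by (simp add: AE_eq_def add_eq_0_iff2)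
  also have "\<dots> \<longleftrightarrow> dual_eq \<Omega> (\<lambda>v. - weak_div \<Omega> \<sigma> v - l v) (L2_inner \<Omega> f)"
  proof
    assume eq: "AE_eq \<Omega> d (\<lambda>x. - f x)"
    show "dual_eq \<Omega> (\<lambda>v. - weak_div \<Omega> \<sigma> v - l v) (L2_inner \<Omega> f)"
      unfolding dual_eq_def
    proof
      fix v assume v: "v \<in> H10 \<Omega>"
      have "L2_inner \<Omega> d v = L2_inner \<Omega> (\<lambda>x. - f x) v"
        using d f v eq by (intro L2_inner_cong) (auto intro: H10_L2 simp: AE_eq_def)
      with d(2)[OF v] show "- weak_div \<Omega> \<sigma> v - l v = L2_inner \<Omega> f v"
        by (simp add: L2_inner_minus_left)
    qed
  next
    assume eq: "dual_eq \<Omega> (\<lambda>v. - weak_div \<Omega> \<sigma> v - l v) (L2_inner \<Omega> f)"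
    show "AE_eq \<Omega> d (\<lambda>x. - f x)"
      unfolding d_def
    proof (rule L2_density_eq)
      show "dual_eq \<Omega> (\<lambda>v. weak_div \<Omega> \<sigma> v + l v) (L2_inner \<Omega> (\<lambda>x. - f x))"
        using eq by (auto simp: dual_eq_def L2_inner_minus_left)
    qed (use f in auto)
  qed
  also have "L2_norm \<Omega> (\<lambda>x. weak_grad \<Omega> u x - \<sigma> x) = 0
      \<longleftrightarrow> AE_eq \<Omega> (\<lambda>x. \<sigma> x - weak_grad \<Omega> u x) (\<lambda>x. 0)"
    using L2_norm_eq_0_iff[OF L2_diff[OF G K(2)]] by (simp add: AE_eq_def eq_commute[of "weak_grad \<Omega> u x" for x])
  finally show ?thesis
    using w K by (auto simp: FO_solution_def Ks_def)
qed

text \<open>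
  Since a solution of the system exists, the minimal value of \<open>J\<close> is zero.
\<close>
lemma FO_iff_LS:
  assumes f: "f \<in> L2 \<Omega>" and g: "g \<in> H10 \<Omega>"
  shows "FO_solution \<Omega> f g w \<longleftrightarrow> LS_solution \<Omega> f g w"
proof
  have J0: "J \<Omega> f g w = 0" if "FO_solution \<Omega> f g w" for w
    using FO_iff_J_eq_0[OF f g, of "fst w" "fst (snd w)" "snd (snd w)"] FO_solution_Ks[OF that] that
    by simp
  show "LS_solution \<Omega> f g w" if "FO_solution \<Omega> f g w"
    using J0[OF that] J_nonneg[OF _ g] FO_solution_Ks[OF that] by (simp add: LS_solution_def)
  assume LS: "LS_solution \<Omega> f g w"
  obtain z where z: "FO_solution \<Omega> f g z" using exists_FO_solution[OF f g] by blast
  have "w \<in> Ks \<Omega> g" using LS by (simp add: LS_solution_def)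
  moreover have "J \<Omega> f g w \<le> J \<Omega> f g z"
    using LS FO_solution_Ks[OF z] by (simp add: LS_solution_def)
  with J0[OF z] J_nonneg[OF \<open>w \<in> Ks \<Omega> g\<close> g, of f] have "J \<Omega> f g w = 0" by simp
  ultimately show "FO_solution \<Omega> f g w"
    using FO_iff_J_eq_0[OF f g, of "fst w" "fst (snd w)" "snd (snd w)"] by simp
qed

text \<open>
  Since \<open>- f\<close> is the density of \<open>div \<sigma> + l\<close> and \<open>\<sigma> = \<nabla>u\<close>, the residuals of the competitor are residuals
  of the difference. In \<open>\<langle>m - l, v - u\<rangle>\<close> the terms \<open>\<langle>m, u - g\<rangle>\<close> and \<open>\<langle>l, v - g\<rangle>\<close> are subtracted and
  nonnegative, while \<open>\<langle>l, u - g\<rangle> = 0\<close>, so it is at most \<open>\<langle>m, v - g\<rangle>\<close>.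
\<close>
lemma coercivity:
  assumes C: "0 < C" "\<And>u. u \<in> H10 \<Omega> \<Longrightarrow> L2_norm \<Omega> u \<le> C * L2_norm \<Omega> (weak_grad \<Omega> u)"
    and t: "0 \<le> t" "t \<le> 1" "t * C\<^sup>2 \<le> 1 / 2"
    and f: "f \<in> L2 \<Omega>" and g: "g \<in> H10 \<Omega>"
    and FO: "FO_solution \<Omega> f g (u, \<sigma>, l)" and K: "(v, \<tau>, m) \<in> Ks \<Omega> g"
  shows "t / 4 * (U_norm \<Omega> (U_diff (v, \<tau>, m) (u, \<sigma>, l)))\<^sup>2 \<le> J \<Omega> f g (v, \<tau>, m)"
proof -
  note Ku = Ks_dest[OF FO_solution_Ks[OF FO]] and Kv = Ks_dest[OF K]
  define w where "w x = v x - u x" for x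
  define \<rho> where "\<rho> x = \<tau> x - \<sigma> x" for x
  define G where "G x = weak_grad \<Omega> v x - weak_grad \<Omega> u x" for x
  define d where "d = L2_density \<Omega> (\<lambda>z. weak_div \<Omega> \<tau> z + m z)"
  define h where "h x = d x + f x" for x
  define p where "p = L2_inner \<Omega> \<rho> G"
  define q where "q = L2_inner \<Omega> h w"
  have d: "d \<in> L2 \<Omega>" "\<And>z. z \<in> H10 \<Omega> \<Longrightarrow> weak_div \<Omega> \<tau> z + m z = L2_inner \<Omega> d z"
    using L2_density_props[OF Kv(6)] by (auto simp: d_def dual_eq_def)
  have wH: "w \<in> H10 \<Omega>" unfolding w_def[abs_def] using Ku Kv by auto
  have h: "h \<in> L2 \<Omega>" unfolding h_def[abs_def] using d f by auto
  have \<rho>: "\<rho> \<in> L2 \<Omega>" unfolding \<rho>_def[abs_def] using Ku Kv by auto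
  have wG: "is_weak_grad \<Omega> w G"
    unfolding w_def[abs_def] G_def[abs_def] using Ku Kv by (intro is_weak_grad_weak_grad_diff H10_H1)
  have G: "G \<in> L2 \<Omega>" using wG by (rule is_weak_grad_L2)
  have gu: "weak_grad \<Omega> u \<in> L2 \<Omega>" "weak_grad \<Omega> v \<in> L2 \<Omega>"
    using Ku Kv by (auto intro: weak_grad_L2 H10_H1)
  have res: "weak_div \<Omega> \<rho> z + (m z - l z) = L2_inner \<Omega> h z" if z: "z \<in> H10 \<Omega>" for z
  proof -
    have "- weak_div \<Omega> \<sigma> z - l z = L2_inner \<Omega> f z"
      using FO z by (auto simp: FO_solution_def dual_eq_def)
    moreover have "weak_div \<Omega> \<rho> z = weak_div \<Omega> \<tau> z - weak_div \<Omega> \<sigma> z"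
      unfolding \<rho>_def[abs_def] by (rule weak_div_diff[OF Kv(2) Ku(2) z])
    moreover have "L2_inner \<Omega> h z = L2_inner \<Omega> d z + L2_inner \<Omega> f z"
      unfolding h_def[abs_def] by (intro L2_inner_add_left d f H10_L2 z)
    ultimately show ?thesis using d(2)[OF z] by linarith
  qed
  have "AE_eq \<Omega> (L2_density \<Omega> (\<lambda>z. weak_div \<Omega> \<rho> z + (m z - l z))) h"
    by (rule L2_density_eq[OF h]) (simp add: dual_eq_def res)
  moreover have "L2_density \<Omega> (\<lambda>z. weak_div \<Omega> \<rho> z + (m z - l z)) \<in> L2 \<Omega>"
    by (rule L2_density_props) (use h res in \<open>auto simp: dual_in_L2_def dual_eq_def\<close>)
  ultimately have norm_h: "L2_norm \<Omega> (L2_density \<Omega> (\<lambda>z. weak_div \<Omega> \<rho> z + (m z - l z))) = L2_norm \<Omega> h"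
    using h by (intro L2_norm_cong)
  have U: "(U_norm \<Omega> (U_diff (v, \<tau>, m) (u, \<sigma>, l)))\<^sup>2
      = (L2_norm \<Omega> G)\<^sup>2 + (L2_norm \<Omega> \<rho>)\<^sup>2 + (L2_norm \<Omega> h)\<^sup>2"
    by (simp add: U_norm_def U_diff_def norm_h weak_grad_norm_eq[OF wG]
        w_def[abs_def, symmetric] \<rho>_def[abs_def, symmetric])
  have "AE x in lebesgue_on \<Omega>. \<sigma> x - weak_grad \<Omega> u x = 0"
    using FO by (auto simp: FO_solution_def AE_eq_def)
  then have "AE_eq \<Omega> (\<lambda>x. weak_grad \<Omega> v x - \<tau> x) (\<lambda>x. G x - \<rho> x)"
    unfolding AE_eq_def by eventually_elim (simp add: G_def \<rho>_def)
  then have "L2_norm \<Omega> (\<lambda>x. weak_grad \<Omega> v x - \<tau> x) = L2_norm \<Omega> (\<lambda>x. G x - \<rho> x)"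
    using G \<rho> gu Kv by (intro L2_norm_cong) auto
  then have J: "J \<Omega> f g (v, \<tau>, m) = (L2_norm \<Omega> h)\<^sup>2
      + ((L2_norm \<Omega> G)\<^sup>2 - 2 * p + (L2_norm \<Omega> \<rho>)\<^sup>2) + m (\<lambda>x. v x - g x)"
    using L2_norm_square_diff[OF G \<rho>] L2_inner_commute[of \<Omega> G \<rho>]
    by (simp add: J_def d_def[symmetric] h_def[abs_def] p_def)
  have "p + q \<le> m (\<lambda>x. v x - g x)"
  proof -
    have "p + q = m w - l w"
      using res[OF wH] weak_div_eq[OF wG \<rho>] by (simp add: p_def q_def)
    also have "m w = m (\<lambda>x. v x - g x) - m (\<lambda>x. u x - g x)"
      unfolding w_def[abs_def] using Ku Kv g by (simp add: Hm1_diff)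
    also have "l w = l (\<lambda>x. v x - g x) - l (\<lambda>x. u x - g x)"
      unfolding w_def[abs_def] using Ku Kv g by (simp add: Hm1_diff)
    also have "l (\<lambda>x. u x - g x) = 0" using FO by (auto simp: FO_solution_def)
    finally show ?thesis
      using Kv(5) Ku(5) Kv(4) Ku(4) H10_diff[OF Ku(1) g] H10_diff[OF Kv(1) g]
      unfolding dual_nonneg_def by fastforce
  qed
  moreover have "\<bar>p\<bar> \<le> L2_norm \<Omega> G * L2_norm \<Omega> \<rho>"
    using L2_Cauchy_Schwarz[OF \<rho> G] by (simp add: p_def mult.commute)
  moreover have "\<bar>q\<bar> \<le> L2_norm \<Omega> h * (C * L2_norm \<Omega> G)"
  proof -
    have "\<bar>q\<bar> \<le> L2_norm \<Omega> h * L2_norm \<Omega> w"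
      unfolding q_def by (rule L2_Cauchy_Schwarz[OF h H10_L2[OF wH]])
    also have "\<dots> \<le> L2_norm \<Omega> h * (C * L2_norm \<Omega> G)"
      using C(2)[OF wH] by (intro mult_left_mono) (auto simp: weak_grad_norm_eq[OF wG])
    finally show ?thesis .
  qed
  ultimately show ?thesis
    unfolding U J using C(1) t complementarity_nonneg[OF K g]
    by (intro coercive_quadratic[where q = q]) auto
qed

text \<open>
  The norm controls the functional only together with the divergence; since the divergence is itself
  controlled by the norm of the field, the functional is determined as well.
\<close>
lemma U_norm_diff_eq_0_imp_U_eq:
  assumes w: "(v, \<tau>, m) \<in> U \<Omega>" "(u, \<sigma>, l) \<in> U \<Omega>"
    and zero: "U_norm \<Omega> (U_diff (v, \<tau>, m) (u, \<sigma>, l)) = 0"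
  shows "U_eq \<Omega> (v, \<tau>, m) (u, \<sigma>, l)"
proof -
  let ?F = "\<lambda>z. weak_div \<Omega> (\<lambda>x. \<tau> x - \<sigma> x) z + (m z - l z)"
  have mem: "v \<in> H10 \<Omega>" "u \<in> H10 \<Omega>" "\<tau> \<in> L2 \<Omega>" "\<sigma> \<in> L2 \<Omega>" using w by (auto simp: U_def)
  have zeros: "L2_norm \<Omega> (weak_grad \<Omega> (\<lambda>x. v x - u x)) = 0" "L2_norm \<Omega> (\<lambda>x. \<tau> x - \<sigma> x) = 0"
      "L2_norm \<Omega> (L2_density \<Omega> ?F) = 0"
    using zero by (auto simp: U_norm_def U_diff_def add_nonneg_eq_0_iff)
  obtain C where "\<And>u. u \<in> H10 \<Omega> \<Longrightarrow> L2_norm \<Omega> u \<le> C * L2_norm \<Omega> (weak_grad \<Omega> u)"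
    using Poincare by metis
  from this[OF H10_diff[OF mem(1,2)]] zeros(1) have "L2_norm \<Omega> (\<lambda>x. v x - u x) = 0"
    using L2_norm_nonneg[of \<Omega> "\<lambda>x. v x - u x"] by simp
  then have "AE_eq \<Omega> v u" by (intro L2_norm_diff_eq_0_imp_AE_eq H10_L2 mem)
  moreover have "AE_eq \<Omega> \<tau> \<sigma>" by (intro L2_norm_diff_eq_0_imp_AE_eq mem zeros)
  moreover have "dual_eq \<Omega> m l"
    unfolding dual_eq_def
  proof
    fix z assume z: "z \<in> H10 \<Omega>"
    obtain h1 h2 where h: "h1 \<in> L2 \<Omega>" "h2 \<in> L2 \<Omega>"
        "dual_eq \<Omega> (\<lambda>v. weak_div \<Omega> \<tau> v + m v) (L2_inner \<Omega> h1)"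
        "dual_eq \<Omega> (\<lambda>v. weak_div \<Omega> \<sigma> v + l v) (L2_inner \<Omega> h2)"
      using w by (auto simp: U_def dual_in_L2_def)
    have "dual_eq \<Omega> ?F (L2_inner \<Omega> (\<lambda>x. h1 x - h2 x))"
      unfolding dual_eq_def
    proof
      fix z assume "z \<in> H10 \<Omega>"
      moreover from this have "weak_div \<Omega> \<tau> z + m z = L2_inner \<Omega> h1 z"
          "weak_div \<Omega> \<sigma> z + l z = L2_inner \<Omega> h2 z"
        using h(3,4) unfolding dual_eq_def by blast+
      ultimately show "?F z = L2_inner \<Omega> (\<lambda>x. h1 x - h2 x) z"
        using weak_div_diff[OF mem(3,4)] L2_inner_diff_left[OF h(1,2) H10_L2] by simp
    qed
    then have "dual_in_L2 \<Omega> ?F" using L2_diff[OF h(1,2)] by (auto simp: dual_in_L2_def)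
    note d = L2_density_props[OF this]
    have "\<bar>L2_inner \<Omega> (L2_density \<Omega> ?F) z\<bar> \<le> 0"
      using L2_Cauchy_Schwarz[OF d(1) H10_L2[OF z]] zeros(3) by simp
    moreover have "\<bar>weak_div \<Omega> (\<lambda>x. \<tau> x - \<sigma> x) z\<bar> \<le> 0"
      using L2_Cauchy_Schwarz[OF L2_diff[OF mem(3,4)] weak_grad_L2[OF H10_H1[OF z]]] zeros(2)
      by (simp add: weak_div_def)
    ultimately show "m z = l z" using d(2) z by (auto simp: dual_eq_def)
  qed
  ultimately show ?thesis by (simp add: U_eq_def)
qed

text \<open>
  The coercivity constant is built from the Poincare constant alone. Uniqueness follows from coercivity,
  as \<open>J\<close> vanishes at every solution.
\<close>
theorem least_squares_well_posed:
  "(\<forall>f\<in>L2 \<Omega>. \<forall>g\<in>H10 \<Omega>.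
      (\<forall>u. FO_solution \<Omega> f g u \<longleftrightarrow> LS_solution \<Omega> f g u) \<and>
      (\<exists>u. LS_solution \<Omega> f g u \<and> (\<forall>w. LS_solution \<Omega> f g w \<longrightarrow> U_eq \<Omega> w u))) \<and>
   (\<exists>C\<^sub>J>0. \<forall>f\<in>L2 \<Omega>. \<forall>g\<in>H10 \<Omega>. \<forall>u. LS_solution \<Omega> f g u \<longrightarrow>
      (\<forall>v\<in>Ks \<Omega> g. J \<Omega> f g v \<ge> C\<^sub>J * (U_norm \<Omega> (U_diff v u))\<^sup>2))"
proof -
  obtain C where C: "0 < C" "\<And>u. u \<in> H10 \<Omega> \<Longrightarrow> L2_norm \<Omega> u \<le> C * L2_norm \<Omega> (weak_grad \<Omega> u)"
    using Poincare by metis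
  define t where "t = min 1 (1 / (2 * C\<^sup>2))"
  have t: "0 < t" "t \<le> 1" "t * C\<^sup>2 \<le> 1 / 2"
  proof -
    have "t * C\<^sup>2 \<le> 1 / (2 * C\<^sup>2) * C\<^sup>2" unfolding t_def by (intro mult_right_mono) auto
    then show "t * C\<^sup>2 \<le> 1 / 2" using C(1) by simp
  qed (use C(1) in \<open>auto simp: t_def\<close>)
  have coercive: "t / 4 * (U_norm \<Omega> (U_diff v u))\<^sup>2 \<le> J \<Omega> f g v"
    if "f \<in> L2 \<Omega>" "g \<in> H10 \<Omega>" "LS_solution \<Omega> f g u" "v \<in> Ks \<Omega> g" for f g u v
    using coercivity[OF C _ t(2,3) that(1,2), of "fst u" "fst (snd u)" "snd (snd u)"
        "fst v" "fst (snd v)" "snd (snd v)"] FO_iff_LS[OF that(1,2)] that t(1) by simp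
  have exists_unique: "\<exists>u. LS_solution \<Omega> f g u \<and> (\<forall>w. LS_solution \<Omega> f g w \<longrightarrow> U_eq \<Omega> w u)"
    if f: "f \<in> L2 \<Omega>" and g: "g \<in> H10 \<Omega>" for f g
  proof -
    obtain u where u: "FO_solution \<Omega> f g u" using exists_FO_solution[OF f g] by blast
    then have LS: "LS_solution \<Omega> f g u" using FO_iff_LS[OF f g] by blast
    have "U_eq \<Omega> w u" if w: "LS_solution \<Omega> f g w" for w
    proof -
      have K: "w \<in> Ks \<Omega> g" "u \<in> Ks \<Omega> g" using w LS by (auto simp: LS_solution_def)
      have "J \<Omega> f g w = 0"
        using FO_iff_J_eq_0[OF f g, of "fst w" "fst (snd w)" "snd (snd w)"] K FO_iff_LS[OF f g] w by simp
      with coercive[OF f g LS K(1)] have "t / 4 * (U_norm \<Omega> (U_diff w u))\<^sup>2 \<le> 0" by simp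
      then have "U_norm \<Omega> (U_diff w u) = 0" using t(1) by (simp add: mult_le_0_iff)
      moreover have "w \<in> U \<Omega>" "u \<in> U \<Omega>" using K by (auto simp: Ks_def)
      ultimately show ?thesis
        using U_norm_diff_eq_0_imp_U_eq[of "fst w" "fst (snd w)" "snd (snd w)"
            "fst u" "fst (snd u)" "snd (snd u)"] by simp
    qed
    with LS show ?thesis by blast
  qed
  show ?thesis
  proof (intro conjI ballI allI exI[of _ "t / 4"] impI)
    show "0 < t / 4" using t(1) by simp
  qed (rule FO_iff_LS exists_unique coercive; assumption)+
qed

end

theorem theorem1:
  fixes \<Omega> :: "(real ^ 'n) set"
  assumes "CARD('n) \<in> {2, 3}"
    and "bounded_Lipschitz_domain \<Omega>" and "polyhedral_boundary \<Omega>"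
  shows
    "(\<forall>f\<in>L2 \<Omega>. \<forall>g\<in>H10 \<Omega>.
        (\<forall>u. FO_solution \<Omega> f g u \<longleftrightarrow> LS_solution \<Omega> f g u) \<and>
        (\<exists>u. LS_solution \<Omega> f g u \<and> (\<forall>w. LS_solution \<Omega> f g w \<longrightarrow> U_eq \<Omega> w u))) \<and>
     (\<exists>C\<^sub>J>0. \<forall>f\<in>L2 \<Omega>. \<forall>g\<in>H10 \<Omega>. \<forall>u. LS_solution \<Omega> f g u \<longrightarrow>
        (\<forall>v\<in>Ks \<Omega> g. J \<Omega> f g v \<ge> C\<^sub>J * (U_norm \<Omega> (U_diff v u))\<^sup>2))"
proof -
  interpret bounded_open_set \<Omega>
    using assms(2) by unfold_locales (auto simp: bounded_Lipschitz_domain_def)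
  show ?thesis by (rule least_squares_well_posed)
qed

end
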